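(* Let $(M_t,G_t)_{t\ge1}$ be the univariate model with targets $\pi_T$, $T\in\mathbb N$, described in the context, and let $\ell=(\ell_t)_{t\ge1}$ be positive scale factors. Assume that the model is independent over time, i.e. $M_t(x,\cdot)=M_t(x',\cdot)$ for all $t$ and all $x,x'\in\mathbb R$. Assume also that for every $T\in\mathbb N$ and $t\in[T]$: $\bar w_t=\log G_t+\log m_t$ is twice continuously differentiable; $\partial_t^2\bar w_t$, $\partial_t^2\bar w_{t+1}$, $\partial_t\partial_{t+1}\bar w_{t+1}$ are Lipschitz-continuous and bounded; and $\pi_T(|\partial_t\bar w_t|^4)<\infty$, $\pi_T(|\partial_t\bar w_{t+1}|^4)<\infty$ (for given $T$, with the convention $\bar w_{T+1}\equiv0$). Let $\mathcal I_{t|T}=\pi_T([\partial_t\log\pi_T]^2)$ and assume $$\mathcal I(\ell):=\sup_{T\in\mathbb N}\sup_{t\in[T]}\ell_t\,\mathcal I_{t|T}<\infty .$$ Let $\bar\alpha_T^N(t)=\overline{\mathbb P}^N_T(K_t\neq0)$ be the limiting i-RW-CSMC acceptance rate (with or without forced move). 1. Without backward sampling: if $N=N(T)$ and there exists $C>0$ such that $N\ge CT$ for all $T$, then $$\inf_{T\in\mathbb N}\inf_{t\in[T]}\bar\alpha^{N}_T(t)\ \ge\ \exp\Bigl(-\frac{\exp(\mathcal I(\ell))}{C}\Bigr)>0 .$$ 2. With backward sampling: for any $N\in\mathbb N$, $$\inf_{T\in\mathbb N}\inf_{t\in[T]}\bar\alpha^N_T(t)\ \ge\ \Bigl(1+\frac{\exp(\mathcal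 I(\ell))}{N}\Bigr)^{-1}>0 .$$
   Context: Notation: $[n]=\{1,\dots,n\}$, $[n]_0=\{0,\dots,n\}$; $\partial_t$ is the derivative with respect to $x_t$; $\pi_T(\varphi)=\int\varphi\,\pi_T$; $\mathbf 1_N$ is the all-ones vector, $I_N$ the identity. Quantities with time index $0$ are ignored. Model. $M_1$ is a probability measure on $\mathbb R$ with Lebesgue density $m_1$; for $t\ge2$, $M_t$ is a Markov kernel on $\mathbb R$ with transition density $m_t(x,y)$; $G_t:\mathbb R\to(0,\infty)$ is measurable. $\pi_T(x_{1:T})\propto m_1(x_1)G_1(x_1)\prod_{t=2}^T m_t(x_{t-1},x_t)G_t(x_t)$ is a probability density on $\mathbb R^T$. $\bar w_t(x_{t-1},x_t)=\log G_t(x_t)+\log m_t(x_{t-1},x_t)$ (a function of $x_1$ only if $t=1$), and for given $T$, $\bar w_{T+1}\equiv0$. (The full target in spatial dimension $D$ is $\pi_T^{\otimes D}$; the law below is the limit, as $D\to\infty$, of the law of the indices in the i-RW-CSMC algorithm.) Selection functions. For $h^{1:N}\in\mathbb R^N$, $h^0:=0$: $\Psi^n(\{h^m\}_{m=1}^N)=\frac{e^{h^n}}{1+\sum_{m=1}^N e^{h^m}}$ for $n\in[N]_0$; $\Phi^n(\{h^m\}_{m=1}^N)=\frac{e^{h^n}}{1-1\wedge e^{h^n}+\sum_{m=1}^N e^{h^m}}$ for $n\in[N]$, $\Phi^0=1-\sum_{n=1}^N\Phi^n$. Let $\Sigma=\tfrac12(I_N+\mathbf 1_N\mathbf 1_N^{\mathsf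 T})$. Limiting law $\overline{\mathbb P}^N_T$. (1) Independently over $t\in[T]$ sample the Gaussian vector $(V_t,W_t)$, $V_t=V_t^{1:N}$, $W_t=W_t^{1:N}$, with means $\mathbb E V_t=\tfrac12\ell_t\pi_T(\partial_t^2\bar w_t)\mathbf 1_N$, $\mathbb E W_t=\tfrac12\ell_t\pi_T(\partial_t^2\bar w_{t+1})\mathbf 1_N$ and covariances $\mathrm{var}(V_t)=\ell_t\pi_T([\partial_t\bar w_t]^2)\Sigma$, $\mathrm{var}(W_t)=\ell_t\pi_T([\partial_t\bar w_{t+1}]^2)\Sigma$, $\mathrm{cov}(V_t,W_t)=\ell_t\pi_T([\partial_t\bar w_t][\partial_t\bar w_{t+1}])\Sigma$; put $V_t^0=W_t^0=0$ and $W_0^n=0$. (2) For $t=1,\dots,T-1$ set $A_t^0=0$ and, conditionally independently for $n\in[N]$, sample $A_t^n=l\in[N]_0$ with probability $\Psi^l(\{V_t^m+W_{t-1}^{A_{t-1}^m}\}_{m=1}^N)$. (3) Sample $K_T=k$ with probability $\Psi^k(\{V_T^m+W_{T-1}^{A_{T-1}^m}\}_{m=1}^N)$ (forced move: $\Phi^k$ instead). (4) For $t=T-1,\dots,1$: without backward sampling $K_t=A_t^{K_{t+1}}$; with backward sampling sample $K_t=k\in[N]_0$ with probability $\Psi^k(\{V_t^m+W_t^m+W_{t-1}^{A_{t-1}^m}\}_{m=1}^N)$. *)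

theory Defs
  imports "HOL-Probability.Probability"
begin

text \<open>Paths \<open>x\<^sub>1, \<dots>, x\<^sub>T\<close> are elements of the product space over the index set \<open>{1..T}\<close>.\<close>

definition target_unnorm ::
    "(real \<Rightarrow> real) \<Rightarrow> (nat \<Rightarrow> real \<Rightarrow> real \<Rightarrow> real) \<Rightarrow> (nat \<Rightarrow> real \<Rightarrow> real) \<Rightarrow> nat \<Rightarrow> (nat \<Rightarrow> real) \<Rightarrow> real"
  where "target_unnorm m1 m G T x =
    m1 (x 1) * G 1 (x 1) * (\<Prod>t=2..T. m t (x (t - 1)) (x t) * G t (x t))"

definition target_density ::
    "(real \<Rightarrow> real) \<Rightarrow> (nat \<Rightarrow> real \<Rightarrow> real \<Rightarrow> real) \<Rightarrow> (nat \<Rightarrow> real \<Rightarrow> real) \<Rightarrow> nat \<Rightarrow> (nat \<Rightarrow> real) \<Rightarrow> real"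
  where "target_density m1 m G T x =
    target_unnorm m1 m G T x / (\<integral>x'. target_unnorm m1 m G T x' \<partial>(\<Pi>\<^sub>M t\<in>{1..T}. lborel))"

definition target ::
    "(real \<Rightarrow> real) \<Rightarrow> (nat \<Rightarrow> real \<Rightarrow> real \<Rightarrow> real) \<Rightarrow> (nat \<Rightarrow> real \<Rightarrow> real) \<Rightarrow> nat \<Rightarrow> (nat \<Rightarrow> real) measure"
  where "target m1 m G T =
    density (\<Pi>\<^sub>M t\<in>{1..T}. lborel) (\<lambda>x. ennreal (target_density m1 m G T x))"

text \<open>If the normalising integral diverges, the Bochner integral in \<open>target_density\<close> is \<open>0\<close> and
  \<open>target\<close> is the null measure, so the last locale assumption includes normalisability.\<close>

locale feynman_kac_model =
  fixes M1 :: "real measure" and m1 :: "real \<Rightarrow> real"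
    and M :: "nat \<Rightarrow> real \<Rightarrow> real measure" and m :: "nat \<Rightarrow> real \<Rightarrow> real \<Rightarrow> real"
    and G :: "nat \<Rightarrow> real \<Rightarrow> real"
  assumes initial_prob: "prob_space M1"
    and initial_measurable: "m1 \<in> borel_measurable borel"
    and initial_nonneg: "\<And>y. 0 \<le> m1 y"
    and initial_density: "M1 = density lborel (\<lambda>y. ennreal (m1 y))"
    and kernel: "\<And>t. 2 \<le> t \<Longrightarrow> M t \<in> borel \<rightarrow>\<^sub>M prob_algebra borel"
    and trans_measurable:
      "\<And>t. 2 \<le> t \<Longrightarrow> (\<lambda>(x, y). m t x y) \<in> borel_measurable (borel \<Otimes>\<^sub>M borel)"
    and trans_nonneg: "\<And>t x y. 2 \<le> t \<Longrightarrow> 0 \<le> m t x y"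
    and trans_density: "\<And>t x. 2 \<le> t \<Longrightarrow> M t x = density lborel (\<lambda>y. ennreal (m t x y))"
    and potential_measurable: "\<And>t. 1 \<le> t \<Longrightarrow> G t \<in> borel_measurable borel"
    and potential_pos: "\<And>t x. 1 \<le> t \<Longrightarrow> 0 < G t x"
    and target_prob: "\<And>T. 1 \<le> T \<Longrightarrow> prob_space (target m1 m G T)"

text \<open>\<open>log_weight m1 m G T t\<close> is \<open>(x\<^bsub>t-1\<^esub>, x\<^sub>t) \<mapsto> log G\<^sub>t(x\<^sub>t) + log m\<^sub>t(x\<^bsub>t-1\<^esub>, x\<^sub>t)\<close>; for \<open>t = 1\<close> the first
  argument is a dummy. It depends on \<open>T\<close> only through the convention that it vanishes for
  \<open>t = T + 1\<close>. Since \<open>ln 0 = 0\<close> in HOL, it is the intended function only where the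
  densities are positive; finiteness of \<open>log m\<^sub>t\<close> is therefore a separate hypothesis.\<close>

definition log_weight ::
    "(real \<Rightarrow> real) \<Rightarrow> (nat \<Rightarrow> real \<Rightarrow> real \<Rightarrow> real) \<Rightarrow> (nat \<Rightarrow> real \<Rightarrow> real) \<Rightarrow> nat \<Rightarrow> nat \<Rightarrow> real \<times> real \<Rightarrow> real"
  where "log_weight m1 m G T t = (\<lambda>(x, y).
    if t = T + 1 then 0
    else if t = 1 then ln (G 1 y) + ln (m1 y)
    else ln (G t y) + ln (m t x y))"

definition twice_cont_differentiable :: "('a::real_normed_vector \<Rightarrow> real) \<Rightarrow> bool"
  where "twice_cont_differentiable f \<longleftrightarrow>
    (\<exists>(f' :: 'a \<Rightarrow> 'a \<Rightarrow>\<^sub>L real) (f'' :: 'a \<Rightarrow> 'a \<Rightarrow>\<^sub>L ('a \<Rightarrow>\<^sub>L real)).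
      (\<forall>x. (f has_derivative blinfun_apply (f' x)) (at x)) \<and>
      (\<forall>x. (f' has_derivative blinfun_apply (f'' x)) (at x)) \<and>
      continuous_on UNIV f'')"

definition partial_fst :: "(real \<times> real \<Rightarrow> real) \<Rightarrow> real \<times> real \<Rightarrow> real"
  where "partial_fst f = (\<lambda>(x, y). deriv (\<lambda>u. f (u, y)) x)"

definition partial_snd :: "(real \<times> real \<Rightarrow> real) \<Rightarrow> real \<times> real \<Rightarrow> real"
  where "partial_snd f = (\<lambda>(x, y). deriv (\<lambda>u. f (x, u)) y)"

definition partial_coord :: "nat \<Rightarrow> ((nat \<Rightarrow> real) \<Rightarrow> real) \<Rightarrow> (nat \<Rightarrow> real) \<Rightarrow> real"
  where "partial_coord t f x = deriv (\<lambda>u. f (x(t := u))) (x t)"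

definition lipschitz_bounded :: "(real \<times> real \<Rightarrow> real) \<Rightarrow> bool"
  where "lipschitz_bounded f \<longleftrightarrow> (\<exists>L. L-lipschitz_on UNIV f) \<and> bounded (range f)"

text \<open>A function of \<open>(x\<^bsub>t-1\<^esub>, x\<^sub>t)\<close> read as a function of the whole path. The coordinates \<open>x\<^sub>0\<close>
  and \<open>x\<^bsub>T+1\<^esub>\<close> carry no information, and are only ever passed to functions that ignore them.\<close>

definition on_path :: "nat \<Rightarrow> (real \<times> real \<Rightarrow> real) \<Rightarrow> (nat \<Rightarrow> real) \<Rightarrow> real"
  where "on_path t f x = f (x (t - 1), x t)"

definition fisher_info ::
    "(real \<Rightarrow> real) \<Rightarrow> (nat \<Rightarrow> real \<Rightarrow> real \<Rightarrow> real) \<Rightarrow> (nat \<Rightarrow> real \<Rightarrow> real) \<Rightarrow> nat \<Rightarrow> nat \<Rightarrow> ennreal"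
  where "fisher_info m1 m G T t =
    (\<integral>\<^sup>+x. ennreal ((partial_coord t (\<lambda>z. ln (target_density m1 m G T z)) x)\<^sup>2) \<partial>target m1 m G T)"

definition sup_fisher_info ::
    "(real \<Rightarrow> real) \<Rightarrow> (nat \<Rightarrow> real \<Rightarrow> real \<Rightarrow> real) \<Rightarrow> (nat \<Rightarrow> real \<Rightarrow> real) \<Rightarrow> (nat \<Rightarrow> real) \<Rightarrow> ennreal"
  where "sup_fisher_info m1 m G \<l> =
    (SUP T\<in>{1..}. SUP t\<in>{1..T}. ennreal (\<l> t) * fisher_info m1 m G T t)"

definition normal_law :: "real \<Rightarrow> real \<Rightarrow> real measure"
  where "normal_law \<mu> v = distr std_normal_distribution borel (\<lambda>z. \<mu> + sqrt v * z)"

text \<open>A random vector is Gaussian, possibly degenerate, if all its linear combinations are.\<close>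

definition is_gaussian_law ::
    "'i set \<Rightarrow> ('i \<Rightarrow> real) \<Rightarrow> ('i \<Rightarrow> 'i \<Rightarrow> real) \<Rightarrow> ('i \<Rightarrow> real) measure \<Rightarrow> bool"
  where "is_gaussian_law I \<mu> C P \<longleftrightarrow>
    prob_space P \<and> sets P = sets (\<Pi>\<^sub>M i\<in>I. borel) \<and>
    (\<forall>a. distr P borel (\<lambda>x. \<Sum>i\<in>I. a i * x i) =
      normal_law (\<Sum>i\<in>I. a i * \<mu> i) (\<Sum>i\<in>I. \<Sum>j\<in>I. a i * a j * C i j))"

text \<open>For finite \<open>I\<close> and symmetric positive semidefinite \<open>C\<close> such a law exists, and it is unique
  by the Cramer-Wold theorem.\<close>

definition gaussian_law ::
    "'i set \<Rightarrow> ('i \<Rightarrow> real) \<Rightarrow> ('i \<Rightarrow> 'i \<Rightarrow> real) \<Rightarrow> ('i \<Rightarrow> real) measure"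
  where "gaussian_law I \<mu> C = (SOME P. is_gaussian_law I \<mu> C P)"

definition Sigma_mat :: "nat \<Rightarrow> nat \<Rightarrow> real"
  where "Sigma_mat i j = ((if i = j then 1 else 0) + 1) / 2"

text \<open>The vector \<open>(V\<^sub>t, W\<^sub>t)\<close> is indexed by \<open>{1..N} <+> {1..N}\<close>, with \<open>Inl n\<close> for \<open>V\<close> and \<open>Inr n\<close>
  for \<open>W\<close>.\<close>

definition VW_mean ::
    "(real \<Rightarrow> real) \<Rightarrow> (nat \<Rightarrow> real \<Rightarrow> real \<Rightarrow> real) \<Rightarrow> (nat \<Rightarrow> real \<Rightarrow> real) \<Rightarrow> (nat \<Rightarrow> real) \<Rightarrow>
      nat \<Rightarrow> nat \<Rightarrow> nat + nat \<Rightarrow> real"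
  where "VW_mean m1 m G \<l> T t i = (case i of
      Inl n \<Rightarrow> \<l> t / 2 *
        (\<integral>x. on_path t (partial_snd (partial_snd (log_weight m1 m G T t))) x \<partial>target m1 m G T)
    | Inr n \<Rightarrow> \<l> t / 2 *
        (\<integral>x. on_path (t + 1) (partial_fst (partial_fst (log_weight m1 m G T (t + 1)))) x
          \<partial>target m1 m G T))"

definition VW_score ::
    "(real \<Rightarrow> real) \<Rightarrow> (nat \<Rightarrow> real \<Rightarrow> real \<Rightarrow> real) \<Rightarrow> (nat \<Rightarrow> real \<Rightarrow> real) \<Rightarrow>
      nat \<Rightarrow> nat \<Rightarrow> nat + nat \<Rightarrow> (nat \<Rightarrow> real) \<Rightarrow> real"
  where "VW_score m1 m G T t i x = (case i of
      Inl n \<Rightarrow> on_path t (partial_snd (log_weight m1 m G T t)) x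
    | Inr n \<Rightarrow> on_path (t + 1) (partial_fst (log_weight m1 m G T (t + 1))) x)"

definition particle :: "nat + nat \<Rightarrow> nat"
  where "particle i = (case i of Inl n \<Rightarrow> n | Inr n \<Rightarrow> n)"

definition VW_cov ::
    "(real \<Rightarrow> real) \<Rightarrow> (nat \<Rightarrow> real \<Rightarrow> real \<Rightarrow> real) \<Rightarrow> (nat \<Rightarrow> real \<Rightarrow> real) \<Rightarrow> (nat \<Rightarrow> real) \<Rightarrow>
      nat \<Rightarrow> nat \<Rightarrow> nat + nat \<Rightarrow> nat + nat \<Rightarrow> real"
  where "VW_cov m1 m G \<l> T t i j =
    \<l> t * (\<integral>x. VW_score m1 m G T t i x * VW_score m1 m G T t j x \<partial>target m1 m G T)
      * Sigma_mat (particle i) (particle j)"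

definition VW_law ::
    "(real \<Rightarrow> real) \<Rightarrow> (nat \<Rightarrow> real \<Rightarrow> real \<Rightarrow> real) \<Rightarrow> (nat \<Rightarrow> real \<Rightarrow> real) \<Rightarrow> (nat \<Rightarrow> real) \<Rightarrow>
      nat \<Rightarrow> nat \<Rightarrow> (nat \<Rightarrow> nat + nat \<Rightarrow> real) measure"
  where "VW_law m1 m G \<l> N T =
    (\<Pi>\<^sub>M t\<in>{1..T}. gaussian_law ({1..N} <+> {1..N}) (VW_mean m1 m G \<l> T t) (VW_cov m1 m G \<l> T t))"

definition V_of :: "(nat \<Rightarrow> nat + nat \<Rightarrow> real) \<Rightarrow> nat \<Rightarrow> nat \<Rightarrow> real"
  where "V_of \<omega> t n = (if n = 0 then 0 else \<omega> t (Inl n))"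

definition W_of :: "(nat \<Rightarrow> nat + nat \<Rightarrow> real) \<Rightarrow> nat \<Rightarrow> nat \<Rightarrow> real"
  where "W_of \<omega> t n = (if t = 0 \<or> n = 0 then 0 else \<omega> t (Inr n))"

text \<open>Only the values \<open>h 1, \<dots>, h N\<close> are used.\<close>

definition Psi :: "nat \<Rightarrow> (nat \<Rightarrow> real) \<Rightarrow> nat \<Rightarrow> real"
  where "Psi N h n = exp (if n = 0 then 0 else h n) / (1 + (\<Sum>k=1..N. exp (h k)))"

definition Phi_pos :: "nat \<Rightarrow> (nat \<Rightarrow> real) \<Rightarrow> nat \<Rightarrow> real"
  where "Phi_pos N h n = exp (h n) / (1 - min 1 (exp (h n)) + (\<Sum>k=1..N. exp (h k)))"

definition Phi :: "nat \<Rightarrow> (nat \<Rightarrow> real) \<Rightarrow> nat \<Rightarrow> real"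
  where "Phi N h n = (if n = 0 then 1 - (\<Sum>k=1..N. Phi_pos N h k) else Phi_pos N h n)"

definition Psi_pmf :: "nat \<Rightarrow> (nat \<Rightarrow> real) \<Rightarrow> nat pmf"
  where "Psi_pmf N h = embed_pmf (\<lambda>n. if n \<le> N then Psi N h n else 0)"

definition Phi_pmf :: "nat \<Rightarrow> (nat \<Rightarrow> real) \<Rightarrow> nat pmf"
  where "Phi_pmf N h = embed_pmf (\<lambda>n. if n \<le> N then Phi N h n else 0)"

lemma pmf_embed_fin:
  fixes p :: "nat \<Rightarrow> real"
  assumes "\<And>n. n \<le> N \<Longrightarrow> 0 \<le> p n" "(\<Sum>n\<le>N. p n) = 1"
  shows "pmf (embed_pmf (\<lambda>n. if n \<le> N then p n else 0)) n = (if n \<le> N then p n else 0)"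
proof (rule pmf_embed_pmf)
  have "(\<integral>\<^sup>+n. ennreal (if n \<le> N then p n else 0) \<partial>count_space UNIV)
      = (\<Sum>n\<le>N. ennreal (if n \<le> N then p n else 0))"
    by (rule nn_integral_count_space') (use assms in auto)
  also have "\<dots> = ennreal (\<Sum>n\<le>N. p n)"
    using assms by (subst sum_ennreal[symmetric]) (auto intro!: sum.cong)
  finally show "(\<integral>\<^sup>+n. ennreal (if n \<le> N then p n else 0) \<partial>count_space UNIV) = 1"
    using assms by simp
qed (use assms in auto)

lemma sum_upto_split:
  fixes p :: "nat \<Rightarrow> real"
  shows "(\<Sum>n\<le>N. p n) = p 0 + (\<Sum>n=1..N. p n)"
proof -
  have "{..N} = insert 0 {1..N}" by auto
  then show ?thesis by simp
qed

lemma pmf_Psi_pmf: "pmf (Psi_pmf N h) n = (if n \<le> N then Psi N h n else 0)"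
proof -
  have pos: "0 < 1 + (\<Sum>k=1..N. exp (h k))"
    by (intro add_pos_nonneg sum_nonneg) auto
  have "(\<Sum>n\<le>N. Psi N h n) = (1 + (\<Sum>k=1..N. exp (h k))) / (1 + (\<Sum>k=1..N. exp (h k)))"
    unfolding sum_upto_split Psi_def add_divide_distrib sum_divide_distrib
    by (auto intro!: sum.cong)
  also have "\<dots> = 1" using pos by simp
  finally show ?thesis
    unfolding Psi_pmf_def using pos by (intro pmf_embed_fin) (auto simp: Psi_def)
qed

lemma pmf_Phi_pmf: "pmf (Phi_pmf N h) n = (if n \<le> N then Phi N h n else 0)"
proof -
  define S where "S = (\<Sum>k=1..N. exp (h k))"
  have S: "exp (h n) \<le> S" if "1 \<le> n" "n \<le> N" for n
    unfolding S_def using that by (intro member_le_sum) auto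
  have le: "0 \<le> Phi_pos N h n \<and> Phi_pos N h n \<le> exp (h n) / S" if "1 \<le> n" "n \<le> N" for n
  proof -
    have "0 < S" using S[OF that] less_le_trans[OF exp_gt_zero] by blast
    then show ?thesis
      unfolding Phi_pos_def S_def[symmetric]
      by (auto intro!: divide_left_mono divide_nonneg_pos mult_pos_pos add_nonneg_pos)
  qed
  have "(\<Sum>k=1..N. Phi_pos N h k) \<le> (\<Sum>k=1..N. exp (h k) / S)"
    using le by (intro sum_mono) auto
  also have "\<dots> = S / S" unfolding S_def by (rule sum_divide_distrib[symmetric])
  also have "\<dots> \<le> 1" by simp
  finally have "0 \<le> Phi N h 0" by (simp add: Phi_def)
  moreover have "(\<Sum>n\<le>N. Phi N h n) = 1"
    unfolding sum_upto_split by (simp add: Phi_def)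
  ultimately show ?thesis
    unfolding Phi_pmf_def using le by (intro pmf_embed_fin) (auto simp: Phi_def)
qed

text \<open>The ancestor indices of generations \<open>1, \<dots>, t\<close>. The default value \<open>0\<close> of the product
  distribution yields \<open>A\<^sub>t\<^sup>0 = 0\<close>.\<close>

primrec ancestors_pmf ::
    "nat \<Rightarrow> (nat \<Rightarrow> nat + nat \<Rightarrow> real) \<Rightarrow> nat \<Rightarrow> (nat \<Rightarrow> nat \<Rightarrow> nat) pmf"
  where
    "ancestors_pmf N \<omega> 0 = return_pmf (\<lambda>t n. 0)"
  | "ancestors_pmf N \<omega> (Suc t) =
      bind_pmf (ancestors_pmf N \<omega> t) (\<lambda>A.
        map_pmf (\<lambda>a. A(Suc t := a))
          (Pi_pmf {1..N} 0 (\<lambda>n. Psi_pmf N (\<lambda>k. V_of \<omega> (Suc t) k + W_of \<omega> t (A t k)))))"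

definition final_index_pmf ::
    "bool \<Rightarrow> nat \<Rightarrow> nat \<Rightarrow> (nat \<Rightarrow> nat + nat \<Rightarrow> real) \<Rightarrow> (nat \<Rightarrow> nat \<Rightarrow> nat) \<Rightarrow> nat pmf"
  where "final_index_pmf forced N T \<omega> A =
    (if forced then Phi_pmf N else Psi_pmf N) (\<lambda>k. V_of \<omega> T k + W_of \<omega> (T - 1) (A (T - 1) k))"

definition backward_index_pmf ::
    "bool \<Rightarrow> nat \<Rightarrow> (nat \<Rightarrow> nat + nat \<Rightarrow> real) \<Rightarrow> (nat \<Rightarrow> nat \<Rightarrow> nat) \<Rightarrow> nat \<Rightarrow> nat \<Rightarrow> nat pmf"
  where "backward_index_pmf backward N \<omega> A t k' =
    (if backward
     then Psi_pmf N (\<lambda>k. V_of \<omega> t k + W_of \<omega> t k + W_of \<omega> (t - 1) (A (t - 1) k))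
     else return_pmf (A t k'))"

text \<open>\<open>trace_pmf \<dots> j\<close> has sampled \<open>K\<^sub>T, K\<^bsub>T-1\<^esub>, \<dots>, K\<^bsub>T-j\<^esub>\<close>.\<close>

primrec trace_pmf ::
    "bool \<Rightarrow> bool \<Rightarrow> nat \<Rightarrow> nat \<Rightarrow> (nat \<Rightarrow> nat + nat \<Rightarrow> real) \<Rightarrow> (nat \<Rightarrow> nat \<Rightarrow> nat) \<Rightarrow> nat \<Rightarrow> (nat \<Rightarrow> nat) pmf"
  where
    "trace_pmf forced backward N T \<omega> A 0 =
      map_pmf (\<lambda>k. (\<lambda>_. 0)(T := k)) (final_index_pmf forced N T \<omega> A)"
  | "trace_pmf forced backward N T \<omega> A (Suc j) =
      bind_pmf (trace_pmf forced backward N T \<omega> A j) (\<lambda>K.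
        map_pmf (\<lambda>k. K(T - Suc j := k))
          (backward_index_pmf backward N \<omega> A (T - Suc j) (K (T - j))))"

definition indices_pmf ::
    "bool \<Rightarrow> bool \<Rightarrow> nat \<Rightarrow> nat \<Rightarrow> (nat \<Rightarrow> nat + nat \<Rightarrow> real) \<Rightarrow> ((nat \<Rightarrow> nat \<Rightarrow> nat) \<times> (nat \<Rightarrow> nat)) pmf"
  where "indices_pmf forced backward N T \<omega> =
    bind_pmf (ancestors_pmf N \<omega> (T - 1)) (\<lambda>A.
      map_pmf (\<lambda>K. (A, K)) (trace_pmf forced backward N T \<omega> A (T - 1)))"

definition limit_law ::
    "(real \<Rightarrow> real) \<Rightarrow> (nat \<Rightarrow> real \<Rightarrow> real \<Rightarrow> real) \<Rightarrow> (nat \<Rightarrow> real \<Rightarrow> real) \<Rightarrow> (nat \<Rightarrow> real) \<Rightarrow>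
      bool \<Rightarrow> bool \<Rightarrow> nat \<Rightarrow> nat \<Rightarrow> ((nat \<Rightarrow> nat \<Rightarrow> nat) \<times> (nat \<Rightarrow> nat)) measure"
  where "limit_law m1 m G \<l> forced backward N T =
    VW_law m1 m G \<l> N T \<bind> (\<lambda>\<omega>. measure_pmf (indices_pmf forced backward N T \<omega>))"

definition acceptance_rate ::
    "(real \<Rightarrow> real) \<Rightarrow> (nat \<Rightarrow> real \<Rightarrow> real \<Rightarrow> real) \<Rightarrow> (nat \<Rightarrow> real \<Rightarrow> real) \<Rightarrow> (nat \<Rightarrow> real) \<Rightarrow>
      bool \<Rightarrow> bool \<Rightarrow> nat \<Rightarrow> nat \<Rightarrow> nat \<Rightarrow> real"
  where "acceptance_rate m1 m G \<l> forced backward N T t =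
    measure (limit_law m1 m G \<l> forced backward N T) {(A, K). K t \<noteq> 0}"

end

theory Submission
  imports Defs
begin

text \<open>In a model that is independent over time, \<open>\<partial>\<^sub>t w\<^bsub>t+1\<^esub> = 0\<close>, so all \<open>W\<^sub>t\<close> vanish almost surely.
  Then the index \<open>K\<^sub>t\<close> is nonzero with conditional probability at least \<open>1 - \<Psi>\<^sup>0(V\<^sub>t)\<close> with backward
  sampling (the forced move only helps), and at least \<open>\<Prod>\<^sub>s (1 - \<Psi>\<^sup>0(V\<^sub>s))\<close> without it, since a lineage
  reaches \<open>0\<close> exactly when one of its independent selections does. Integration by parts gives
  \<open>V\<^sub>t\<^sup>n\<close> the law \<open>N(- c / 2, c)\<close> with \<open>c = \<l>\<^sub>t I\<^sub>t\<close>, hence \<open>E exp (- V\<^sub>t\<^sup>n) = exp c\<close>. Finally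
  \<open>1 - \<Psi>\<^sup>0(V) = 1 / (1 + 1 / S)\<close> with \<open>S = \<Sum>\<^sub>n exp V\<^sup>n\<close>; the AM-HM inequality
  \<open>1 / S \<le> N\<^sup>-\<^sup>2 \<Sum>\<^sub>n exp (- V\<^sup>n)\<close> and Jensen's inequality for \<open>x \<mapsto> 1 / (1 + x)\<close> yield
  \<open>E (1 - \<Psi>\<^sup>0(V)) \<ge> 1 / (1 + exp c / N)\<close>. Only the marginal laws of the \<open>V\<^sub>t\<^sup>n\<close> matter.\<close>

section \<open>Measurability of finitely supported kernels\<close>

text \<open>The ancestor and index arrays range over uncountable function types. A finite support
  that is uniform in \<omega> still turns every mixture into a finite sum of measurable
  weights.\<close>

definition finite_pmf_kernel :: "'a measure \<Rightarrow> ('a \<Rightarrow> 'b pmf) \<Rightarrow> bool"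
  where "finite_pmf_kernel M f \<longleftrightarrow>
    (\<exists>F. finite F \<and> (\<forall>\<omega>. set_pmf (f \<omega>) \<subseteq> F)) \<and> (\<forall>x. (\<lambda>\<omega>. pmf (f \<omega>) x) \<in> borel_measurable M)"

lemma finite_pmf_kernel_const: "finite (set_pmf p) \<Longrightarrow> finite_pmf_kernel M (\<lambda>_. p)"
  by (auto simp: finite_pmf_kernel_def)

lemma finite_pmf_kernel_bind:
  assumes f: "finite_pmf_kernel M f" and g: "\<And>x. finite_pmf_kernel M (g x)"
  shows "finite_pmf_kernel M (\<lambda>\<omega>. bind_pmf (f \<omega>) (\<lambda>x. g x \<omega>))"
proof -
  obtain F where F: "finite F" "\<And>\<omega>. set_pmf (f \<omega>) \<subseteq> F"
    using f by (auto simp: finite_pmf_kernel_def)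
  obtain H where H: "\<And>x. finite (H x)" "\<And>x \<omega>. set_pmf (g x \<omega>) \<subseteq> H x"
    using g unfolding finite_pmf_kernel_def by metis
  have "set_pmf (bind_pmf (f \<omega>) (\<lambda>x. g x \<omega>)) \<subseteq> (\<Union>x\<in>F. H x)" for \<omega>
    unfolding set_bind_pmf using F(2)[of \<omega>] H(2)[of _ \<omega>] by blast
  moreover have "finite (\<Union>x\<in>F. H x)" using F H by auto
  moreover have "(\<lambda>\<omega>. pmf (bind_pmf (f \<omega>) (\<lambda>x. g x \<omega>)) y) \<in> borel_measurable M" for y
  proof -
    have [measurable]: "(\<lambda>\<omega>. pmf (f \<omega>) x) \<in> borel_measurable M"
      "(\<lambda>\<omega>. pmf (g x \<omega>) z) \<in> borel_measurable M" for x z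
      using f g by (auto simp: finite_pmf_kernel_def)
    have "pmf (bind_pmf (f \<omega>) (\<lambda>x. g x \<omega>)) y = (\<Sum>x\<in>F. pmf (f \<omega>) x * pmf (g x \<omega>) y)" for \<omega>
      unfolding pmf_bind by (subst integral_measure_pmf[OF F(1)]) (use F(2) in \<open>auto simp: mult.commute\<close>)
    then show ?thesis by simp
  qed
  ultimately show ?thesis unfolding finite_pmf_kernel_def by blast
qed

lemma finite_pmf_kernel_map:
  assumes "finite_pmf_kernel M f"
  shows "finite_pmf_kernel M (\<lambda>\<omega>. map_pmf h (f \<omega>))"
  unfolding map_pmf_def
  by (intro finite_pmf_kernel_bind assms finite_pmf_kernel_const) auto

lemma finite_pmf_kernel_Pi:
  assumes I: "finite I" and p: "\<And>i. finite_pmf_kernel M (p i)"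
  shows "finite_pmf_kernel M (\<lambda>\<omega>. Pi_pmf I d (\<lambda>i. p i \<omega>))"
proof -
  obtain H where H: "\<And>x. finite (H x)" "\<And>x \<omega>. set_pmf (p x \<omega>) \<subseteq> H x"
    using p unfolding finite_pmf_kernel_def by metis
  have [measurable]: "(\<lambda>\<omega>. pmf (p i \<omega>) x) \<in> borel_measurable M" for i x
    using p by (auto simp: finite_pmf_kernel_def)
  have "set_pmf (Pi_pmf I d (\<lambda>i. p i \<omega>)) \<subseteq> PiE_dflt I d H" for \<omega>
    unfolding set_Pi_pmf[OF I] PiE_dflt_def using H(2) by auto
  moreover have "finite (PiE_dflt I d H)"
    using I H by (intro finite_PiE_dflt) auto
  moreover have "(\<lambda>\<omega>. pmf (Pi_pmf I d (\<lambda>i. p i \<omega>)) x) \<in> borel_measurable M" for x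
    \<comment> \<open>A configuration that differs from \<open>d\<close> outside \<open>I\<close>
      has mass 0 for every \<omega>; any other has a finite product of measurable masses.\<close>
    by (cases "\<forall>i. i \<notin> I \<longrightarrow> x i = d") (auto simp: pmf_Pi I)
  ultimately show ?thesis unfolding finite_pmf_kernel_def by blast
qed

lemma finite_pmf_kernel_measurable:
  assumes f: "finite_pmf_kernel M f"
  shows "(\<lambda>\<omega>. measure_pmf (f \<omega>)) \<in> M \<rightarrow>\<^sub>M subprob_algebra (count_space UNIV)"
proof (rule measurable_subprob_algebra)
  fix S :: "'b set"
  obtain F where F: "finite F" "\<And>\<omega>. set_pmf (f \<omega>) \<subseteq> F"
    using f by (auto simp: finite_pmf_kernel_def)
  have [measurable]: "(\<lambda>\<omega>. pmf (f \<omega>) x) \<in> borel_measurable M" for x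
    using f by (auto simp: finite_pmf_kernel_def)
  \<comment> \<open>All mass lies in \<open>F\<close>, so even an arbitrary \<open>S\<close> has a
    finite sum of point masses as its probability.\<close>
  have "emeasure (measure_pmf (f \<omega>)) S = (\<Sum>x\<in>S \<inter> F. ennreal (pmf (f \<omega>) x))" for \<omega>
  proof -
    have "emeasure (measure_pmf (f \<omega>)) S = emeasure (measure_pmf (f \<omega>)) (S \<inter> F)"
      using F(2)[of \<omega>] by (intro emeasure_eq_AE) (auto simp: AE_measure_pmf_iff)
    also have "\<dots> = (\<Sum>x\<in>S \<inter> F. ennreal (pmf (f \<omega>) x))"
      using F(1) by (subst emeasure_measure_pmf_finite) auto
    finally show ?thesis .
  qed
  then show "(\<lambda>\<omega>. emeasure (measure_pmf (f \<omega>)) S) \<in> borel_measurable M" by simp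
qed (auto intro: measure_pmf.subprob_space_axioms)

lemma finite_pmf_kernel_Psi:
  assumes [measurable]: "\<And>k. (\<lambda>\<omega>. h \<omega> k) \<in> borel_measurable M"
  shows "finite_pmf_kernel M (\<lambda>\<omega>. Psi_pmf N (h \<omega>))"
proof -
  have "set_pmf (Psi_pmf N (h \<omega>)) \<subseteq> {..N}" for \<omega>
    by (auto simp: set_pmf_iff pmf_Psi_pmf split: if_splits)
  moreover have "(\<lambda>\<omega>. pmf (Psi_pmf N (h \<omega>)) x) \<in> borel_measurable M" for x
    unfolding pmf_Psi_pmf Psi_def by auto
  ultimately show ?thesis unfolding finite_pmf_kernel_def by blast
qed

lemma finite_pmf_kernel_Phi:
  assumes [measurable]: "\<And>k. (\<lambda>\<omega>. h \<omega> k) \<in> borel_measurable M"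
  shows "finite_pmf_kernel M (\<lambda>\<omega>. Phi_pmf N (h \<omega>))"
proof -
  have "set_pmf (Phi_pmf N (h \<omega>)) \<subseteq> {..N}" for \<omega>
    by (auto simp: set_pmf_iff pmf_Phi_pmf split: if_splits)
  moreover have "(\<lambda>\<omega>. pmf (Phi_pmf N (h \<omega>)) x) \<in> borel_measurable M" for x
    unfolding pmf_Phi_pmf Phi_def Phi_pos_def by auto
  ultimately show ?thesis unfolding finite_pmf_kernel_def by blast
qed

section \<open>Kernels of the index sampling steps\<close>

context
  fixes M :: "(nat \<Rightarrow> nat + nat \<Rightarrow> real) measure"
  assumes coord [measurable]: "\<And>t i. (\<lambda>\<omega>. \<omega> t i) \<in> borel_measurable M"
begin

lemma V_of_measurable [measurable]: "(\<lambda>\<omega>. V_of \<omega> t k) \<in> borel_measurable M"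
  unfolding V_of_def by simp

lemma W_of_measurable [measurable]: "(\<lambda>\<omega>. W_of \<omega> t k) \<in> borel_measurable M"
  unfolding W_of_def by simp

lemma ancestors_kernel: "finite_pmf_kernel M (\<lambda>\<omega>. ancestors_pmf N \<omega> t)"
proof (induction t)
  case (Suc t)
  then show ?case
    by (auto intro!: finite_pmf_kernel_bind finite_pmf_kernel_map finite_pmf_kernel_Pi
        finite_pmf_kernel_Psi)
qed (auto intro: finite_pmf_kernel_const)

lemma final_index_kernel: "finite_pmf_kernel M (\<lambda>\<omega>. final_index_pmf forced N T \<omega> A)"
  unfolding final_index_pmf_def
  by (cases forced) (auto intro!: finite_pmf_kernel_Phi finite_pmf_kernel_Psi)

lemma trace_kernel: "finite_pmf_kernel M (\<lambda>\<omega>. trace_pmf forced backward N T \<omega> A j)"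
proof (induction j)
  case 0
  then show ?case by (auto intro!: finite_pmf_kernel_map final_index_kernel)
next
  case (Suc j)
  have "finite_pmf_kernel M (\<lambda>\<omega>. backward_index_pmf backward N \<omega> A t k)" for t k
    unfolding backward_index_pmf_def
    by (cases backward) (auto intro!: finite_pmf_kernel_Psi finite_pmf_kernel_const)
  with Suc show ?case by (auto intro!: finite_pmf_kernel_bind finite_pmf_kernel_map)
qed

lemma indices_kernel: "finite_pmf_kernel M (\<lambda>\<omega>. indices_pmf forced backward N T \<omega>)"
  unfolding indices_pmf_def
  by (intro finite_pmf_kernel_bind finite_pmf_kernel_map ancestors_kernel trace_kernel)

end

section \<open>Lineages and acceptance probabilities\<close>

text \<open>In \<open>lineage A s t k\<close>, the index \<open>k\<close> belongs to generation \<open>t + 1\<close>, and its ancestor in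
  generation \<open>s\<close> is returned.\<close>

primrec lineage :: "(nat \<Rightarrow> nat \<Rightarrow> nat) \<Rightarrow> nat \<Rightarrow> nat \<Rightarrow> nat \<Rightarrow> nat"
  where
    "lineage A s 0 k = k"
  | "lineage A s (Suc t) k = (if s \<le> Suc t then lineage A s t (A (Suc t) k) else k)"

lemma lineage_trivial: "t < s \<Longrightarrow> lineage A s t k = k"
  by (cases t) auto

text \<open>The recursion of \<open>lineage\<close> peels off the youngest generation, whereas the
  trace descends to one older generation at a time. Both unfold the same composition of ancestor
  maps, from opposite ends.\<close>

lemma lineage_bottom: "1 \<le> s \<Longrightarrow> s \<le> t \<Longrightarrow> lineage A s t k = A s (lineage A (Suc s) t k)"
proof (induction t arbitrary: k)
  case (Suc t)
  show ?case
  proof (cases "s = Suc t")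
    case True
    then show ?thesis by (simp add: lineage_trivial)
  next
    case False
    then show ?thesis using Suc by auto
  qed
qed simp

lemma lineage_upd_above: "t < u \<Longrightarrow> lineage (A(u := a)) s t k = lineage A s t k"
  by (induction t arbitrary: k) auto

text \<open>Steps after the \<open>j\<close>-th write only to times below \<open>T - j\<close>. The
  bound \<open>i \<le> T\<close> keeps truncated subtraction from merging distinct times.\<close>

lemma trace_marginal_eq:
  assumes "j \<le> i" "i \<le> T"
  shows "map_pmf (\<lambda>K. K (T - j)) (trace_pmf forced backward N T \<omega> A i) =
    map_pmf (\<lambda>K. K (T - j)) (trace_pmf forced backward N T \<omega> A j)"
  using assms
proof (induction i rule: dec_induct)
  case (step n)
  have "T - j \<noteq> T - Suc n" using step by auto
  then have "map_pmf (\<lambda>K. K (T - j)) (trace_pmf forced backward N T \<omega> A (Suc n)) =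
      map_pmf (\<lambda>K. K (T - j)) (trace_pmf forced backward N T \<omega> A n)"
    by (simp add: map_bind_pmf pmf.map_comp comp_def map_pmf_const) (simp add: map_pmf_def)
  with step show ?case by simp
qed simp

text \<open>Each step sends the current index through an ancestor map, so the trace is a
  deterministic function of the final index. That index belongs to generation \<open>T\<close>, with
  parents in generation \<open>T - 1\<close>, whence the argument \<open>T - 1\<close> of
  \<open>lineage\<close>.\<close>

lemma trace_marginal_no_backward:
  assumes "j < T"
  shows "map_pmf (\<lambda>K. K (T - j)) (trace_pmf forced False N T \<omega> A j) =
    map_pmf (lineage A (T - j) (T - 1)) (final_index_pmf forced N T \<omega> A)"
  using assms
proof (induction j)
  case 0
  then have "lineage A (T - 0) (T - 1) = (\<lambda>k. k)" by (intro ext) (simp add: lineage_trivial)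
  then show ?case by (simp add: pmf.map_comp comp_def)
next
  case (Suc j)
  have eq: "T - j = Suc (T - Suc j)" using Suc by simp
  have "map_pmf (\<lambda>K. K (T - Suc j)) (trace_pmf forced False N T \<omega> A (Suc j)) =
      map_pmf (\<lambda>K. A (T - Suc j) (K (T - j))) (trace_pmf forced False N T \<omega> A j)"
    by (simp add: map_bind_pmf pmf.map_comp comp_def backward_index_pmf_def) (simp add: map_pmf_def)
  also have "\<dots> = map_pmf (A (T - Suc j)) (map_pmf (\<lambda>K. K (T - j)) (trace_pmf forced False N T \<omega> A j))"
    by (simp add: pmf.map_comp comp_def)
  also have "\<dots> = map_pmf (\<lambda>k. A (T - Suc j) (lineage A (Suc (T - Suc j)) (T - 1) k))
      (final_index_pmf forced N T \<omega> A)"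
    using Suc eq by (simp add: pmf.map_comp comp_def)
  also have "(\<lambda>k. A (T - Suc j) (lineage A (Suc (T - Suc j)) (T - 1) k)) = lineage A (T - Suc j) (T - 1)"
    using Suc.prems by (intro ext lineage_bottom[symmetric]) auto
  finally show ?case .
qed

lemma Psi_pmf_cong: "(\<And>k. 1 \<le> k \<Longrightarrow> k \<le> N \<Longrightarrow> h k = h' k) \<Longrightarrow> Psi_pmf N h = Psi_pmf N h'"
  by (intro pmf_eqI) (auto simp: pmf_Psi_pmf Psi_def intro!: arg_cong2[where f="(/)"] sum.cong)

text \<open>\<open>W_of\<close> will be known to vanish only at indices up to \<open>N\<close>; this
  bound allows that to be used at ancestor indices.\<close>

lemma ancestors_le: "A \<in> set_pmf (ancestors_pmf N \<omega> t) \<Longrightarrow> A s k \<le> N"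
proof (induction t arbitrary: A s k)
  case (Suc t)
  have *: "i \<le> N" if "i \<in> set_pmf (Psi_pmf N h)" for i h
    using that by (auto simp: set_pmf_iff pmf_Psi_pmf split: if_splits)
  from Suc.prems obtain B a where B: "B \<in> set_pmf (ancestors_pmf N \<omega> t)" "A = B(Suc t := a)"
    and a: "a \<in> set_pmf (Pi_pmf {1..N} 0
      (\<lambda>n. Psi_pmf N (\<lambda>k. V_of \<omega> (Suc t) k + W_of \<omega> t (B t k))))"
    by (auto simp: set_bind_pmf)
  have "a k \<le> N"
    using a * unfolding set_Pi_pmf[OF finite_atLeastAtMost] PiE_dflt_def
    by (cases "k \<in> {1..N}") auto
  then show ?case using Suc.IH[OF B(1)] B(2) by simp
qed simp

section \<open>Mass of the selection functions at the reference index\<close>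

lemma one_minus_Psi_zero:
  "1 - Psi N h 0 = (\<Sum>k=1..N. exp (h k)) / (1 + (\<Sum>k=1..N. exp (h k)))"
proof -
  have "0 < 1 + (\<Sum>k=1..N. exp (h k))" by (intro add_pos_nonneg sum_nonneg) auto
  then show ?thesis by (simp add: Psi_def field_simps)
qed

lemma one_minus_Psi_zero_bounds: "0 \<le> 1 - Psi N h 0" "1 - Psi N h 0 \<le> 1"
proof -
  have "0 < 1 + (\<Sum>k=1..N. exp (h k))" by (intro add_pos_nonneg sum_nonneg) auto
  moreover have "0 \<le> (\<Sum>k=1..N. exp (h k))" by (intro sum_nonneg) auto
  ultimately show "0 \<le> 1 - Psi N h 0" "1 - Psi N h 0 \<le> 1"
    unfolding one_minus_Psi_zero by (auto simp: field_simps)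
qed

lemma prob_pmf_nonzero: "measure_pmf.prob p {k. k \<noteq> 0} = 1 - pmf p 0"
  for p :: "nat pmf"
proof -
  have "{k. k \<noteq> 0} = space (measure_pmf p) - {0::nat}" by auto
  then show ?thesis by (simp only: measure_pmf.prob_compl sets_measure_pmf UNIV_I measure_pmf_single)
qed

text \<open>The forced move only shrinks denominators, from \<open>1 + S\<close> to
  \<open>1 - min 1 (exp (h k)) + S\<close>. Every nonzero index gains mass, so index 0 loses
  mass.\<close>

lemma Phi_zero_le_Psi_zero: "Phi N h 0 \<le> Psi N h 0"
proof -
  define S where "S = (\<Sum>k=1..N. exp (h k))"
  have "exp (h k) / (1 + S) \<le> Phi_pos N h k" if "k \<in> {1..N}" for k
  proof -
    have "exp (h k) \<le> S" unfolding S_def using that by (intro member_le_sum) auto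
    then have "0 < S" using exp_gt_zero[of "h k"] by linarith
    moreover have "0 < 1 - min 1 (exp (h k)) + S"
      using \<open>0 < S\<close> min.cobounded1[of 1 "exp (h k)"] by linarith
    ultimately show ?thesis unfolding Phi_pos_def S_def[symmetric]
      by (intro divide_left_mono) (auto simp: min_def)
  qed
  then have "(\<Sum>k=1..N. exp (h k) / (1 + S)) \<le> (\<Sum>k=1..N. Phi_pos N h k)"
    by (intro sum_mono) auto
  moreover have "(\<Sum>k=1..N. exp (h k) / (1 + S)) = 1 - Psi N h 0"
    unfolding one_minus_Psi_zero S_def by (simp add: sum_divide_distrib)
  ultimately show ?thesis unfolding Phi_def by simp
qed

section \<open>Nonzero index probabilities for fixed Gaussian weights\<close>

lemma final_nonzero_prob:
  "1 - Psi N h 0 \<le> measure_pmf.prob ((if forced then Phi_pmf N else Psi_pmf N) h) {k. k \<noteq> 0}"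
  unfolding prob_pmf_nonzero using Phi_zero_le_Psi_zero[of N h] by (simp add: pmf_Phi_pmf pmf_Psi_pmf)

text \<open>Earlier ancestors enter the selection weights only through \<open>W\<close>. Without it,
  the new generation is drawn independently of all earlier ones.\<close>

lemma ancestors_no_interaction:
  assumes "\<And>l. l \<le> N \<Longrightarrow> W_of \<omega> t l = 0"
  shows "ancestors_pmf N \<omega> (Suc t) =
      bind_pmf (ancestors_pmf N \<omega> t) (\<lambda>A.
        map_pmf (\<lambda>a. A(Suc t := a)) (Pi_pmf {1..N} 0 (\<lambda>n. Psi_pmf N (V_of \<omega> (Suc t)))))"
  unfolding ancestors_pmf.simps
  by (intro bind_pmf_cong refl arg_cong[where f="map_pmf _"] arg_cong[where f="Pi_pmf _ _"] ext Psi_pmf_cong)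
    (use assms ancestors_le in auto)

lemma prob_bind_pmf:
  "measure_pmf.prob (bind_pmf p f) S = (\<integral>x. measure_pmf.prob (f x) S \<partial>measure_pmf p)"
  unfolding measure_pmf_bind
  by (subst measure_pmf.measure_bind[where N="count_space UNIV"]) (auto simp: space_subprob_algebra intro: measure_pmf.subprob_space_axioms)

text \<open>Induction from the youngest generation: the parent of \<open>k\<close> is nonzero with
  probability \<open>1 - Psi N (V_of \<omega> (Suc t)) 0\<close>, independently of the older
  generations, and the induction hypothesis then applies to that parent.\<close>

lemma lineage_nonzero_prob:
  assumes W: "\<And>u l. u \<le> t \<Longrightarrow> l \<le> N \<Longrightarrow> W_of \<omega> u l = 0"
    and k: "1 \<le> k" "k \<le> N" and s: "1 \<le> s"
  shows "(\<Prod>u\<in>{s..t}. 1 - Psi N (V_of \<omega> u) 0)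
    \<le> measure_pmf.prob (ancestors_pmf N \<omega> t) {A. lineage A s t k \<noteq> 0}"
  using W k
proof (induction t arbitrary: k)
  case 0
  with s show ?case by simp
next
  case (Suc t)
  let ?q = "\<lambda>u. 1 - Psi N (V_of \<omega> u) 0"
  show ?case
  proof (cases "s \<le> Suc t")
    case False
    then have "(\<Prod>u\<in>{s..Suc t}. ?q u) = 1" "{A. lineage A s (Suc t) k \<noteq> 0} = UNIV"
      using Suc.prems by auto
    then show ?thesis by (simp only: measure_pmf_UNIV)
  next
    case True
    let ?V = "V_of \<omega> (Suc t)"
    let ?f = "\<lambda>A. lineage A s t"
    have "map_pmf (\<lambda>A. lineage A s (Suc t) k) (ancestors_pmf N \<omega> (Suc t)) =
      bind_pmf (ancestors_pmf N \<omega> t) (\<lambda>A. map_pmf (?f A)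
         (map_pmf (\<lambda>a. a k) (Pi_pmf {1..N} 0 (\<lambda>n. Psi_pmf N ?V))))"
      using True Suc.prems
      by (subst ancestors_no_interaction)
        (auto simp: map_bind_pmf pmf.map_comp comp_def lineage_upd_above)
    also have "\<dots> = bind_pmf (ancestors_pmf N \<omega> t) (\<lambda>A. bind_pmf (Psi_pmf N ?V) (\<lambda>l. return_pmf (?f A l)))"
      unfolding Pi_pmf_component[OF finite_atLeastAtMost] using Suc.prems by (simp add: map_pmf_def)
    \<comment> \<open>Exchanging the two independent draws fixes the parent \<open>l\<close> first,
      so the older generations can be treated for a given \<open>l\<close>.\<close>
    also have "\<dots> = bind_pmf (Psi_pmf N ?V) (\<lambda>l. map_pmf (\<lambda>A. ?f A l) (ancestors_pmf N \<omega> t))"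
      unfolding map_pmf_def by (rule bind_commute_pmf)
    finally have eq0: "map_pmf (\<lambda>A. lineage A s (Suc t) k) (ancestors_pmf N \<omega> (Suc t)) =
      bind_pmf (Psi_pmf N ?V) (\<lambda>l. map_pmf (\<lambda>A. ?f A l) (ancestors_pmf N \<omega> t))" .
    have eq: "measure_pmf.prob (ancestors_pmf N \<omega> (Suc t)) {A. lineage A s (Suc t) k \<noteq> 0} =
        (\<integral>l. measure_pmf.prob (map_pmf (\<lambda>A. ?f A l) (ancestors_pmf N \<omega> t)) {k. k \<noteq> 0} \<partial>Psi_pmf N ?V)"
      unfolding prob_bind_pmf[symmetric]
      by (simp only: measure_map_pmf vimage_def mem_Collect_eq flip: eq0)
    have "(\<Prod>u\<in>{s..Suc t}. ?q u) = (\<Prod>u\<in>{s..t}. ?q u) * ?q (Suc t)"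
      using True by (simp add: prod.nat_ivl_Suc')
    also have "\<dots> = (\<Prod>u\<in>{s..t}. ?q u) * measure_pmf.prob (Psi_pmf N ?V) {k. k \<noteq> 0}"
      unfolding prob_pmf_nonzero pmf_Psi_pmf by simp
    also have "\<dots> = (\<integral>l. (\<Prod>u\<in>{s..t}. ?q u) * indicator {k. k \<noteq> 0} l \<partial>Psi_pmf N ?V)"
      by simp
    \<comment> \<open>At \<open>l = 0\<close> the left integrand is 0; at every other
      \<open>l\<close> it is bounded by the induction hypothesis.\<close>
    also have "\<dots> \<le> (\<integral>l. measure_pmf.prob (map_pmf (\<lambda>A. ?f A l) (ancestors_pmf N \<omega> t)) {k. k \<noteq> 0} \<partial>Psi_pmf N ?V)"
    proof (rule integral_mono_AE)
      show "AE l in Psi_pmf N ?V. (\<Prod>u\<in>{s..t}. ?q u) * indicator {k. k \<noteq> 0} l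
          \<le> measure_pmf.prob (map_pmf (\<lambda>A. ?f A l) (ancestors_pmf N \<omega> t)) {k. k \<noteq> 0}"
        unfolding AE_measure_pmf_iff
      proof
        fix l assume "l \<in> set_pmf (Psi_pmf N ?V)"
        then have "l \<le> N" by (auto simp: set_pmf_iff pmf_Psi_pmf split: if_splits)
        then show "(\<Prod>u\<in>{s..t}. ?q u) * indicator {k. k \<noteq> 0} l
          \<le> measure_pmf.prob (map_pmf (\<lambda>A. ?f A l) (ancestors_pmf N \<omega> t)) {k. k \<noteq> 0}"
          using Suc.IH[of l] Suc.prems(1)
          by (cases "l = 0") (auto simp: indicator_def vimage_def)
      qed
    next
      show "integrable (measure_pmf (Psi_pmf N ?V))
        (\<lambda>l. measure_pmf.prob (map_pmf (\<lambda>A. ?f A l) (ancestors_pmf N \<omega> t)) {k. k \<noteq> 0})"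
        by (rule measure_pmf.integrable_const_bound[where B=1]) auto
    next
      show "integrable (measure_pmf (Psi_pmf N ?V)) (\<lambda>l. (\<Prod>u\<in>{s..t}. ?q u) * indicator {k. k \<noteq> 0} l)"
        by (rule measure_pmf.integrable_const_bound[where B="\<bar>\<Prod>u\<in>{s..t}. ?q u\<bar>"])
          (auto simp: indicator_def)
    qed
    finally show ?thesis unfolding eq .
  qed
qed

lemma indices_marginal:
  assumes "1 \<le> t" "t \<le> T"
  shows "measure_pmf.prob (indices_pmf forced backward N T \<omega>) {(A, K). K t \<noteq> 0} =
    (\<integral>A. measure_pmf.prob (map_pmf (\<lambda>K. K t) (trace_pmf forced backward N T \<omega> A (T - t))) {k. k \<noteq> 0}
      \<partial>ancestors_pmf N \<omega> (T - 1))"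
proof -
  \<comment> \<open>Writing \<open>t\<close> as \<open>T - (T - t)\<close> matches
    \<open>trace_marginal_eq\<close> with \<open>j = T - t\<close>.\<close>
  have "measure_pmf.prob (map_pmf (\<lambda>K. (A, K)) (trace_pmf forced backward N T \<omega> A (T - 1))) {(A, K). K t \<noteq> 0}
    = measure_pmf.prob (map_pmf (\<lambda>K. K (T - (T - t))) (trace_pmf forced backward N T \<omega> A (T - 1))) {k. k \<noteq> 0}" for A
    using assms by (simp add: vimage_def)
  also have "\<dots> A = measure_pmf.prob (map_pmf (\<lambda>K. K t) (trace_pmf forced backward N T \<omega> A (T - t))) {k. k \<noteq> 0}" for A
    using assms by (subst trace_marginal_eq) auto
  finally show ?thesis unfolding indices_pmf_def prob_bind_pmf by simp
qed

text \<open>The final selection, forced or not, supplies the factor at \<open>T\<close>; the lineage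
  of the selected index through generations \<open>T - 1\<close> down to \<open>t\<close> supplies
  the others.\<close>

lemma acceptance_no_backward:
  assumes W: "\<And>u l. u \<le> T \<Longrightarrow> l \<le> N \<Longrightarrow> W_of \<omega> u l = 0" and t: "1 \<le> t" "t \<le> T"
  shows "(\<Prod>u\<in>{t..T}. 1 - Psi N (V_of \<omega> u) 0)
    \<le> measure_pmf.prob (indices_pmf forced False N T \<omega>) {(A, K). K t \<noteq> 0}"
proof -
  let ?q = "\<lambda>u. 1 - Psi N (V_of \<omega> u) 0"
  define F where "F = (if forced then Phi_pmf N else Psi_pmf N) (V_of \<omega> T)"
  let ?R = "ancestors_pmf N \<omega> (T - 1)"
  have F: "final_index_pmf forced N T \<omega> A = F" if "A \<in> set_pmf ?R" for A
    using ancestors_le[OF that] W[of "T - 1"] by (simp add: F_def final_index_pmf_def)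
  have "measure_pmf.prob (indices_pmf forced False N T \<omega>) {(A, K). K t \<noteq> 0} =
    (\<integral>A. measure_pmf.prob (map_pmf (lineage A t (T - 1)) (final_index_pmf forced N T \<omega> A)) {k. k \<noteq> 0} \<partial>?R)"
    unfolding indices_marginal[OF t] using trace_marginal_no_backward[of "T - t" T] t by simp
  also have "\<dots> = (\<integral>A. measure_pmf.prob (map_pmf (lineage A t (T - 1)) F) {k. k \<noteq> 0} \<partial>?R)"
    by (intro integral_cong_AE) (auto simp: AE_measure_pmf_iff F)
  also have "\<dots> = measure_pmf.prob (bind_pmf ?R (\<lambda>A. bind_pmf F (\<lambda>k. return_pmf (lineage A t (T - 1) k)))) {k. k \<noteq> 0}"
    unfolding prob_bind_pmf[of ?R] by (simp add: map_pmf_def)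
  \<comment> \<open>The law \<open>F\<close> does not involve \<open>A\<close>, so the final index
    can be drawn first and its lineage followed afterwards.\<close>
  also have "\<dots> = (\<integral>k. measure_pmf.prob ?R {A. lineage A t (T - 1) k \<noteq> 0} \<partial>F)"
    by (subst bind_commute_pmf, subst prob_bind_pmf, fold map_pmf_def) (simp add: vimage_def)
  finally have eq: "measure_pmf.prob (indices_pmf forced False N T \<omega>) {(A, K). K t \<noteq> 0} = \<dots>" .
  have T: "T = Suc (T - 1)" using t by simp
  have "(\<Prod>u\<in>{t..T}. ?q u) = (\<Prod>u\<in>{t..T - 1}. ?q u) * ?q T"
    using t prod.nat_ivl_Suc'[of t "T - 1" ?q] T by (simp add: mult.commute)
  also have "\<dots> \<le> (\<Prod>u\<in>{t..T - 1}. ?q u) * measure_pmf.prob F {k. k \<noteq> 0}"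
    unfolding F_def by (intro mult_left_mono final_nonzero_prob prod_nonneg ballI one_minus_Psi_zero_bounds)
  also have "\<dots> = (\<integral>k. (\<Prod>u\<in>{t..T - 1}. ?q u) * indicator {k. k \<noteq> 0} k \<partial>F)"
    by simp
  also have "\<dots> \<le> (\<integral>k. measure_pmf.prob ?R {A. lineage A t (T - 1) k \<noteq> 0} \<partial>F)"
  proof (rule integral_mono_AE)
    show "AE k in F. (\<Prod>u\<in>{t..T - 1}. ?q u) * indicator {k. k \<noteq> 0} k
        \<le> measure_pmf.prob ?R {A. lineage A t (T - 1) k \<noteq> 0}"
      unfolding AE_measure_pmf_iff
    proof
      fix k assume "k \<in> set_pmf F"
      then have "k \<le> N"
        by (auto simp: F_def set_pmf_iff pmf_Psi_pmf pmf_Phi_pmf split: if_splits)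
      then show "(\<Prod>u\<in>{t..T - 1}. ?q u) * indicator {k. k \<noteq> 0} k
        \<le> measure_pmf.prob ?R {A. lineage A t (T - 1) k \<noteq> 0}"
        using lineage_nonzero_prob[of "T - 1" N \<omega> k t] W t
        by (cases "k = 0") auto
    qed
  next
    show "integrable (measure_pmf F) (\<lambda>k. measure_pmf.prob ?R {A. lineage A t (T - 1) k \<noteq> 0})"
      by (rule measure_pmf.integrable_const_bound[where B=1]) auto
  next
    show "integrable (measure_pmf F) (\<lambda>k. (\<Prod>u\<in>{t..T - 1}. ?q u) * indicator {k. k \<noteq> 0} k)"
      by (rule measure_pmf.integrable_const_bound[where B="\<bar>\<Prod>u\<in>{t..T - 1}. ?q u\<bar>"])
        (auto simp: indicator_def)
  qed
  finally show ?thesis unfolding eq .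
qed

text \<open>With all \<open>W\<close> equal to 0, a backward draw at \<open>t < T\<close> is a fresh
  selection with weights from \<open>V_of \<omega> t\<close> alone. At \<open>t = T\<close> the
  index is the final selection, which is where a forced move can occur.\<close>

lemma acceptance_backward:
  assumes W: "\<And>u l. u \<le> T \<Longrightarrow> l \<le> N \<Longrightarrow> W_of \<omega> u l = 0" and t: "1 \<le> t" "t \<le> T"
  shows "1 - Psi N (V_of \<omega> t) 0
    \<le> measure_pmf.prob (indices_pmf forced True N T \<omega>) {(A, K). K t \<noteq> 0}"
proof -
  let ?R = "ancestors_pmf N \<omega> (T - 1)"
  let ?p = "\<lambda>A. measure_pmf.prob (map_pmf (\<lambda>K. K t) (trace_pmf forced True N T \<omega> A (T - t))) {k. k \<noteq> 0}"
  have "1 - Psi N (V_of \<omega> t) 0 \<le> ?p A" if A: "A \<in> set_pmf ?R" for A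
  proof (cases "t = T")
    case True
    have "final_index_pmf forced N T \<omega> A = (if forced then Phi_pmf N else Psi_pmf N) (V_of \<omega> T)"
      using ancestors_le[OF A] W[of "T - 1"] by (simp add: final_index_pmf_def)
    then show ?thesis using final_nonzero_prob[of N "V_of \<omega> T" forced] True
      by (simp add: pmf.map_comp comp_def)
  next
    case False
    then obtain j where j: "T - t = Suc j" "T - Suc j = t" using t
      by (metis Suc_diff_Suc diff_diff_cancel le_neq_implies_less)
    have "Psi_pmf N (\<lambda>k. V_of \<omega> t k + W_of \<omega> t k + W_of \<omega> (t - 1) (A (t - 1) k)) = Psi_pmf N (V_of \<omega> t)"
      using ancestors_le[OF A] W[of "t - 1"] W[of t] t by (intro Psi_pmf_cong) auto
    then have "map_pmf (\<lambda>K. K t) (trace_pmf forced True N T \<omega> A (T - t)) = Psi_pmf N (V_of \<omega> t)"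
      unfolding j(1) by (simp add: map_bind_pmf pmf.map_comp comp_def backward_index_pmf_def j)
    then show ?thesis using final_nonzero_prob[of N "V_of \<omega> t" False] by simp
  qed
  then have "(\<integral>A. 1 - Psi N (V_of \<omega> t) 0 \<partial>?R) \<le> (\<integral>A. ?p A \<partial>?R)"
    by (intro integral_mono_AE measure_pmf.integrable_const_bound[where B=1])
      (use one_minus_Psi_zero_bounds[of N "V_of \<omega> t"] in \<open>auto simp: AE_measure_pmf_iff\<close>)
  then show ?thesis unfolding indices_marginal[OF t] by simp
qed

section \<open>Gaussian laws\<close>

text \<open>Characteristic functions also cover the degenerate case \<open>v = 0\<close>, in which
  there is no density.\<close>

lemma char_normal_law:
  assumes "0 \<le> v"
  shows "char (normal_law \<mu> v) t = iexp (t * \<mu>) * complex_of_real (exp (- (v * t\<^sup>2) / 2))"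
proof -
  have "char (normal_law \<mu> v) t = (CLINT z|std_normal_distribution. iexp (t * \<mu>) * iexp ((t * sqrt v) * z))"
    unfolding char_def normal_law_def
    by (subst integral_distr) (auto simp: algebra_simps exp_add[symmetric] intro!: Bochner_Integration.integral_cong)
  also have "\<dots> = iexp (t * \<mu>) * char std_normal_distribution (t * sqrt v)"
    unfolding char_def by simp
  finally show ?thesis
    using assms by (simp add: char_std_normal_distribution power_mult_distrib mult.commute)
qed

lemma real_distribution_normal_law: "real_distribution (normal_law \<mu> v)"
proof -
  interpret real_distribution std_normal_distribution by (rule real_dist_normal_dist)
  show ?thesis unfolding normal_law_def by (rule real_distribution_distr) simp
qed

text \<open>Independence factorises the characteristic function, and Levy's uniqueness theorem
  identifies the law.\<close>

lemma distr_std_normal_affine: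
  fixes b :: "'k \<Rightarrow> real"
  assumes J: "finite J"
  shows "distr (\<Pi>\<^sub>M k\<in>J. std_normal_distribution) borel (\<lambda>z. \<mu> + (\<Sum>k\<in>J. b k * z k)) =
    normal_law \<mu> (\<Sum>k\<in>J. (b k)\<^sup>2)"
proof (rule Levy_uniqueness)
  interpret S: real_distribution std_normal_distribution by (rule real_dist_normal_dist)
  interpret product_sigma_finite "\<lambda>_::'k. std_normal_distribution"
    by (simp add: product_sigma_finite_def S.sigma_finite_measure_axioms)
  let ?P = "\<Pi>\<^sub>M k\<in>J. std_normal_distribution"
  interpret P: prob_space ?P by (rule prob_space_PiM) (rule S.prob_space_axioms)
  have [measurable]: "(\<lambda>z. z k) \<in> borel_measurable ?P" if "k \<in> J" for k
    using measurable_component_singleton[OF that, of "\<lambda>_. std_normal_distribution"] by simp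
  show "real_distribution (distr ?P borel (\<lambda>z. \<mu> + (\<Sum>k\<in>J. b k * z k)))"
    by (rule P.real_distribution_distr) simp
  show "real_distribution (normal_law \<mu> (\<Sum>k\<in>J. (b k)\<^sup>2))"
    by (rule real_distribution_normal_law)
  show "char (distr ?P borel (\<lambda>z. \<mu> + (\<Sum>k\<in>J. b k * z k))) = char (normal_law \<mu> (\<Sum>k\<in>J. (b k)\<^sup>2))"
  proof
    fix t :: real
    have "char (distr ?P borel (\<lambda>z. \<mu> + (\<Sum>k\<in>J. b k * z k))) t =
      (CLINT z|?P. iexp (t * \<mu>) * (\<Prod>k\<in>J. iexp ((t * b k) * z k)))"
      unfolding char_def
      by (subst integral_distr)
        (auto simp: algebra_simps exp_add sum_distrib_left exp_sum J intro!: Bochner_Integration.integral_cong)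
    also have "\<dots> = iexp (t * \<mu>) * (\<Prod>k\<in>J. CLINT z|std_normal_distribution. iexp ((t * b k) * z))"
      by (subst integral_mult_right_zero, subst product_integral_prod[OF J])
        (auto intro!: S.integrable_const_bound[where B=1])
    also have "\<dots> = iexp (t * \<mu>) * (\<Prod>k\<in>J. complex_of_real (exp (- ((t * b k)\<^sup>2) / 2)))"
    proof -
      have "(CLINT z|std_normal_distribution. iexp ((t * b k) * z)) =
          complex_of_real (exp (- ((t * b k)\<^sup>2) / 2))" for k
        using fun_cong[OF char_std_normal_distribution, of "t * b k"] by (simp only: char_def)
      then show ?thesis by (simp only:)
    qed
    also have "(\<Prod>k\<in>J. complex_of_real (exp (- ((t * b k)\<^sup>2) / 2))) =
        complex_of_real (exp (\<Sum>k\<in>J. - ((t * b k)\<^sup>2) / 2))"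
      by (simp add: exp_sum J)
    also have "(\<Sum>k\<in>J. - ((t * b k)\<^sup>2) / 2) = - ((\<Sum>k\<in>J. (b k)\<^sup>2) * t\<^sup>2) / 2"
      by (simp add: sum_negf power_mult_distrib mult.commute flip: sum_divide_distrib sum_distrib_left)
    finally show "char (distr ?P borel (\<lambda>z. \<mu> + (\<Sum>k\<in>J. b k * z k))) t =
        char (normal_law \<mu> (\<Sum>k\<in>J. (b k)\<^sup>2)) t"
      by (simp add: char_normal_law sum_nonneg)
  qed
qed

text \<open>\<open>gaussian_law\<close> is a choice and carries information only once a witness
  exists. A factorisation of the covariance as \<open>B\<close> times its transpose yields one: the
  image of independent standard normals under the affine map with matrix \<open>B\<close>.\<close>

lemma is_gaussian_law_exists:
  fixes B :: "'i \<Rightarrow> 'k \<Rightarrow> real"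
  assumes "finite I" "finite J"
    and C: "\<And>i j. i \<in> I \<Longrightarrow> j \<in> I \<Longrightarrow> C i j = (\<Sum>k\<in>J. B i k * B j k)"
  shows "\<exists>P. is_gaussian_law I \<mu> C P"
proof -
  interpret S: real_distribution std_normal_distribution by (rule real_dist_normal_dist)
  let ?P = "\<Pi>\<^sub>M k\<in>J. std_normal_distribution"
  interpret P: prob_space ?P by (rule prob_space_PiM) (rule S.prob_space_axioms)
  have [measurable]: "(\<lambda>z. z k) \<in> borel_measurable ?P" if "k \<in> J" for k
    using measurable_component_singleton[OF that, of "\<lambda>_. std_normal_distribution"] by simp
  define F where "F = (\<lambda>z. \<lambda>i\<in>I. \<mu> i + (\<Sum>k\<in>J. B i k * z k))"
  have F [measurable]: "F \<in> ?P \<rightarrow>\<^sub>M (\<Pi>\<^sub>M i\<in>I. borel)"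
    unfolding F_def by measurable
  have "distr (distr ?P (\<Pi>\<^sub>M i\<in>I. borel) F) borel (\<lambda>x. \<Sum>i\<in>I. a i * x i) =
      normal_law (\<Sum>i\<in>I. a i * \<mu> i) (\<Sum>i\<in>I. \<Sum>j\<in>I. a i * a j * C i j)" for a
  proof -
    have "distr (distr ?P (\<Pi>\<^sub>M i\<in>I. borel) F) borel (\<lambda>x. \<Sum>i\<in>I. a i * x i) =
        distr ?P borel (\<lambda>z. \<Sum>i\<in>I. a i * F z i)"
      by (subst distr_distr) (auto simp: comp_def)
    also have "(\<lambda>z. \<Sum>i\<in>I. a i * F z i) =
        (\<lambda>z. (\<Sum>i\<in>I. a i * \<mu> i) + (\<Sum>k\<in>J. (\<Sum>i\<in>I. a i * B i k) * z k))"
    proof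
      fix z
      have "(\<Sum>i\<in>I. a i * F z i) = (\<Sum>i\<in>I. a i * \<mu> i) + (\<Sum>i\<in>I. \<Sum>k\<in>J. a i * B i k * z k)"
        by (simp add: F_def algebra_simps sum.distrib sum_distrib_left)
      also have "(\<Sum>i\<in>I. \<Sum>k\<in>J. a i * B i k * z k) = (\<Sum>k\<in>J. (\<Sum>i\<in>I. a i * B i k) * z k)"
        by (subst sum.swap) (simp add: sum_distrib_right)
      finally show "(\<Sum>i\<in>I. a i * F z i) =
        (\<Sum>i\<in>I. a i * \<mu> i) + (\<Sum>k\<in>J. (\<Sum>i\<in>I. a i * B i k) * z k)" .
    qed
    also have "distr ?P borel \<dots> = normal_law (\<Sum>i\<in>I. a i * \<mu> i) (\<Sum>k\<in>J. (\<Sum>i\<in>I. a i * B i k)\<^sup>2)"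
      by (rule distr_std_normal_affine) fact
    also have "(\<Sum>k\<in>J. (\<Sum>i\<in>I. a i * B i k)\<^sup>2) = (\<Sum>k\<in>J. \<Sum>i\<in>I. \<Sum>j\<in>I. a i * a j * (B i k * B j k))"
      by (simp add: power2_eq_square sum_product algebra_simps)
    also have "\<dots> = (\<Sum>i\<in>I. \<Sum>j\<in>I. \<Sum>k\<in>J. a i * a j * (B i k * B j k))"
      by (subst sum.swap) (intro sum.cong refl sum.swap)
    also have "\<dots> = (\<Sum>i\<in>I. \<Sum>j\<in>I. a i * a j * C i j)"
      by (intro sum.cong refl) (simp add: C sum_distrib_left)
    finally show ?thesis .
  qed
  moreover have "prob_space (distr ?P (\<Pi>\<^sub>M i\<in>I. borel) F)"
    by (rule P.prob_space_distr) (rule F)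
  ultimately show ?thesis unfolding is_gaussian_law_def by (metis sets_distr)
qed

text \<open>The defining property is tested on the unit vector at \<open>i\<close>.\<close>

lemma is_gaussian_law_marginal:
  assumes P: "is_gaussian_law I \<mu> C P" and I: "finite I" and i: "i \<in> I"
  shows "distr P borel (\<lambda>x. x i) = normal_law (\<mu> i) (C i i)"
proof -
  define a :: "'a \<Rightarrow> real" where "a = (\<lambda>j. if j = i then 1 else 0)"
  have a: "(\<Sum>j\<in>I. a j * y j) = y i" for y :: "'a \<Rightarrow> real"
    using I i by (simp add: a_def if_distrib[of "\<lambda>u. u * _"] cong: if_cong)
  have "(\<Sum>j\<in>I. \<Sum>k\<in>I. a j * a k * C j k) = (\<Sum>j\<in>I. a j * (\<Sum>k\<in>I. a k * C j k))"
    by (simp add: sum_distrib_left mult.assoc)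
  then have "(\<Sum>j\<in>I. \<Sum>k\<in>I. a j * a k * C j k) = C i i"
    by (simp only: a)
  moreover have "distr P borel (\<lambda>x. \<Sum>i\<in>I. a i * x i) =
      normal_law (\<Sum>i\<in>I. a i * \<mu> i) (\<Sum>i\<in>I. \<Sum>j\<in>I. a i * a j * C i j)"
    using P unfolding is_gaussian_law_def by blast
  ultimately show ?thesis by (simp only: a)
qed

section \<open>Exponential moments and expected selection probabilities\<close>

lemma AE_normal_law_degenerate: "AE x in normal_law \<mu> 0. x = \<mu>"
  unfolding normal_law_def by (subst AE_distr_iff) auto

text \<open>Completing the square turns the tilted standard normal density into one with mean
  \<open>- sqrt v\<close>. At \<open>\<mu> = - c / 2\<close> and \<open>v = c\<close> the value is
  \<open>exp c\<close>, the source of the exponential in the final bounds.\<close>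

lemma has_bochner_integral_exp_normal_law:
  assumes "0 \<le> v"
  shows "has_bochner_integral (normal_law \<mu> v) (\<lambda>x. exp (- x)) (exp (v / 2 - \<mu>))"
proof -
  have eq: "normal_density 0 1 z * exp (- (\<mu> + sqrt v * z)) = exp (v / 2 - \<mu>) * normal_density (- sqrt v) 1 z" for z
    using assms by (simp add: normal_density_def exp_add[symmetric] field_simps power2_eq_square)
  have "has_bochner_integral lborel (\<lambda>z. exp (v / 2 - \<mu>) * normal_density (- sqrt v) 1 z) (exp (v / 2 - \<mu>) * 1)"
    by (intro has_bochner_integral_mult_right) (simp add: has_bochner_integral_iff)
  then have "has_bochner_integral std_normal_distribution (\<lambda>z. exp (- (\<mu> + sqrt v * z))) (exp (v / 2 - \<mu>))"
    by (subst has_bochner_integral_density) (simp_all only: real_scaleR_def eq, simp_all)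
  then show ?thesis
    unfolding normal_law_def by (subst has_bochner_integral_distr) auto
qed

text \<open>Writing \<open>1 - Psi N h 0 = 1 / (1 + 1 / S)\<close>, the AM-HM inequality bounds \<open>1 / S\<close> by a linear
  function of the \<open>exp (- h k)\<close>, and \<open>x \<mapsto> 1 / (1 + x)\<close> lies above its tangent at \<open>c\<close>.\<close>

lemma one_minus_Psi_zero_ge_tangent:
  fixes h :: "nat \<Rightarrow> real"
  assumes N: "1 \<le> N" and c: "0 \<le> c"
  shows "1 / (1 + c) - ((\<Sum>k=1..N. exp (- h k)) / (real N)\<^sup>2 - c) / (1 + c)\<^sup>2 \<le> 1 - Psi N h 0"
proof -
  define S where "S = (\<Sum>k=1..N. exp (h k))"
  define x where "x = (\<Sum>k=1..N. exp (- h k)) / (real N)\<^sup>2"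
  have S: "0 < S" unfolding S_def using N by (intro sum_pos) auto
  have x: "0 \<le> x" unfolding x_def by (intro divide_nonneg_nonneg sum_nonneg) auto
  \<comment> \<open>The factors multiply to 1 in each term, so the left side is the square of
    \<open>N\<close>; this is the AM-HM inequality.\<close>
  have "(\<Sum>k=1..N. exp (h k / 2) * exp (- h k / 2))\<^sup>2
      \<le> (\<Sum>k=1..N. (exp (h k / 2))\<^sup>2) * (\<Sum>k=1..N. (exp (- h k / 2))\<^sup>2)"
    by (rule Cauchy_Schwarz_ineq_sum)
  then have "(real N)\<^sup>2 \<le> S * (\<Sum>k=1..N. exp (- h k))"
    by (simp add: S_def flip: exp_add exp_double)
  then have "1 \<le> S * x" using N by (simp add: x_def field_simps)
  then have "1 / (1 + x) \<le> S / (1 + S)"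
    using S x by (simp add: field_simps)
  moreover have "S / (1 + S) = 1 - Psi N h 0"
    unfolding Psi_def S_def[symmetric] using S by (simp add: field_simps)
  moreover have "1 / (1 + c) - (x - c) / (1 + c)\<^sup>2 \<le> 1 / (1 + x)"
  proof -
    \<comment> \<open>The gap between the convex function and its tangent is an explicit nonnegative
      quotient.\<close>
    have "1 / p - (1 / q - (p - q) / q\<^sup>2) = (p - q)\<^sup>2 / (p * q\<^sup>2)" if "0 < p" "0 < q" for p q :: real
      using that by (simp add: field_simps power2_eq_square)
    from this[of "1 + x" "1 + c"]
    have "1 / (1 + x) - (1 / (1 + c) - (x - c) / (1 + c)\<^sup>2) = (x - c)\<^sup>2 / ((1 + x) * (1 + c)\<^sup>2)"
      using x c by simp
    also have "\<dots> \<ge> 0" using x by simp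
    finally show ?thesis by simp
  qed
  ultimately show ?thesis by (simp add: x_def)
qed

lemma Psi_measurable [measurable]:
  assumes [measurable]: "\<And>k. k \<in> {1..N} \<Longrightarrow> (\<lambda>\<omega>. h \<omega> k) \<in> borel_measurable M"
  shows "(\<lambda>\<omega>. Psi N (h \<omega>) 0) \<in> borel_measurable M"
  unfolding Psi_def by simp

text \<open>Jensen's inequality in tangent form. The tangent bound is linear in the
  \<open>exp (- h \<omega> k)\<close>, so correlation between the coordinates is harmless.\<close>

lemma (in prob_space) expectation_one_minus_Psi_zero:
  assumes N: "1 \<le> N" and c: "0 \<le> c"
    and meas [measurable]: "\<And>k. k \<in> {1..N} \<Longrightarrow> random_variable borel (\<lambda>\<omega>. h \<omega> k)"
    and h: "\<And>k. k \<in> {1..N} \<Longrightarrow> distr M borel (\<lambda>\<omega>. h \<omega> k) = normal_law (- c / 2) c"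
  shows "inverse (1 + exp c / real N) \<le> expectation (\<lambda>\<omega>. 1 - Psi N (h \<omega>) 0)"
proof -
  \<comment> \<open>\<open>e\<close> is the mean of the sum of the
    \<open>exp (- h \<omega> k)\<close> divided by the square of \<open>N\<close>. With the tangent
    taken there, the linear correction integrates to 0.\<close>
  define e where "e = exp c / real N"
  have e: "0 \<le> e" by (simp add: e_def)
  have hb: "has_bochner_integral M (\<lambda>\<omega>. exp (- h \<omega> k)) (exp c)" if "k \<in> {1..N}" for k
  proof -
    have "has_bochner_integral (distr M borel (\<lambda>\<omega>. h \<omega> k)) (\<lambda>x. exp (- x)) (exp c)"
      unfolding h[OF that] using has_bochner_integral_exp_normal_law[OF c, of "- c / 2"] by simp
    then show ?thesis
      unfolding has_bochner_integral_iff
      by (simp add: integrable_distr_eq[OF meas[OF that]] integral_distr[OF meas[OF that]])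
  qed
  have "has_bochner_integral M
      (\<lambda>\<omega>. 1 / (1 + e) - ((\<Sum>k=1..N. exp (- h \<omega> k)) / (real N)\<^sup>2 - e) / (1 + e)\<^sup>2)
      (1 / (1 + e) - ((\<Sum>k=1..N. exp c) / (real N)\<^sup>2 - e) / (1 + e)\<^sup>2)"
    using hb by (intro has_bochner_integral_diff has_bochner_integral_divide_zero has_bochner_integral_sum)
      (auto simp: has_bochner_integral_iff prob_space)
  moreover have "(\<Sum>k=1..N. exp c) / (real N)\<^sup>2 = e"
    using N by (simp add: e_def power2_eq_square)
  ultimately have hb': "has_bochner_integral M
      (\<lambda>\<omega>. 1 / (1 + e) - ((\<Sum>k=1..N. exp (- h \<omega> k)) / (real N)\<^sup>2 - e) / (1 + e)\<^sup>2) (1 / (1 + e))"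
    by simp
  have bounds: "0 \<le> Psi N (h \<omega>) 0" "Psi N (h \<omega>) 0 \<le> 1" for \<omega>
    using sum_nonneg[of "{1..N}" "\<lambda>k. exp (h \<omega> k)"] by (auto simp: Psi_def)
  have "1 / (1 + e) = expectation
      (\<lambda>\<omega>. 1 / (1 + e) - ((\<Sum>k=1..N. exp (- h \<omega> k)) / (real N)\<^sup>2 - e) / (1 + e)\<^sup>2)"
    using hb' by (simp add: has_bochner_integral_iff)
  also have "\<dots> \<le> expectation (\<lambda>\<omega>. 1 - Psi N (h \<omega>) 0)"
  proof (rule integral_mono)
    show "integrable M (\<lambda>\<omega>. 1 - Psi N (h \<omega>) 0)"
      using bounds by (intro integrable_const_bound[where B=1]) auto
  qed (use hb' one_minus_Psi_zero_ge_tangent[OF N e] in \<open>auto simp: has_bochner_integral_iff\<close>)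
  finally show ?thesis by (simp add: e_def inverse_eq_divide)
qed

section \<open>Bartlett identity\<close>

text \<open>Averaging \<open>F (x + 1) - F x\<close> over \<open>x\<close> gives \<open>0\<close> by translation invariance and the integral of
  the derivative by Fubini, so no limits of \<open>F\<close> at infinity are needed.\<close>

lemma integral_deriv_eq_0:
  fixes F f :: "real \<Rightarrow> real"
  assumes F: "\<And>x. (F has_real_derivative f x) (at x)" and cont: "continuous_on UNIV f"
    and int_F: "integrable lborel F" and int_f: "integrable lborel f"
  shows "(\<integral>x. f x \<partial>lborel) = 0"
proof -
  have [measurable]: "f \<in> borel_measurable borel"
    using int_f by (simp add: borel_measurable_integrable)
  define h where "h = (\<lambda>u x. indicator {0..1::real} u *\<^sub>R f (x + u))"
  have trans: "integrable lborel (\<lambda>x. q (x + u))" "(\<integral>x. q (x + u) \<partial>lborel) = (\<integral>x. q x \<partial>lborel)"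
    if "integrable lborel q" for q :: "real \<Rightarrow> real" and u
    using lborel_integrable_real_affine[OF that, of 1 u] lborel_integral_real_affine[of 1 q u]
    by (simp_all add: add.commute)
  \<comment> \<open>By translation invariance each slice at \<open>u\<close> in
    \<open>[0, 1]\<close> has the L1 norm of \<open>f\<close>, and all other slices vanish.\<close>
  have "integrable (lborel \<Otimes>\<^sub>M lborel) (case_prod h)"
  proof (rule lborel_pair.Fubini_integrable)
    show "case_prod h \<in> borel_measurable (lborel \<Otimes>\<^sub>M lborel)"
      unfolding h_def by measurable
    have "(\<integral>x. norm (case_prod h (u, x)) \<partial>lborel) = indicator {0..1} u *\<^sub>R (\<integral>x. \<bar>f x\<bar> \<partial>lborel)" for u
      using trans(2)[of "\<lambda>x. \<bar>f x\<bar>" u] int_f by (simp add: h_def abs_mult)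
    then show "integrable lborel (\<lambda>u. \<integral>x. norm (case_prod h (u, x)) \<partial>lborel)"
      by (simp only:) (auto intro!: integrable_scaleR_left)
    show "AE u in lborel. integrable lborel (\<lambda>x. case_prod h (u, x))"
      using trans(1)[OF int_f] by (simp add: h_def)
  qed
  then have "(\<integral>x. (\<integral>u. h u x \<partial>lborel) \<partial>lborel) = (\<integral>u. (\<integral>x. h u x \<partial>lborel) \<partial>lborel)"
    by (rule lborel_pair.Fubini_integral)
  moreover have "(\<integral>x. h u x \<partial>lborel) = indicator {0..1} u *\<^sub>R (\<integral>x. f x \<partial>lborel)" for u
    using trans(2)[OF int_f, of u] by (simp add: h_def)
  moreover have "(\<integral>u. h u x \<partial>lborel) = F (x + 1) - F x" for x
  proof -
    have "(\<integral>u. indicator {0..1} u *\<^sub>R f (x + u) \<partial>lborel) = F (x + 1) - F (x + 0)"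
    proof (rule integral_FTC_atLeastAtMost)
      fix u :: real
      have "((\<lambda>u. F (x + u)) has_real_derivative f (x + u)) (at u)"
        using DERIV_shift[of F "f (x + u)" u x] F[of "x + u"] by (simp add: add.commute)
      then show "((\<lambda>u. F (x + u)) has_vector_derivative f (x + u)) (at u within {0..1})"
        by (simp add: has_real_derivative_iff_has_vector_derivative has_vector_derivative_at_within)
    next
      show "continuous_on {0..1} (\<lambda>u. f (x + u))"
        by (intro continuous_on_compose2[OF cont] continuous_intros) auto
    qed simp
    then show ?thesis by (simp add: h_def)
  qed
  ultimately show ?thesis using trans[OF int_F, of 1] int_F by simp
qed

text \<open>The second Bartlett identity: \<open>(exp g)'' = (g'' + g'\<^sup>2) exp g\<close> integrates to \<open>0\<close>.\<close>

lemma integral_second_deriv_log_density: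
  fixes g g' g'' :: "real \<Rightarrow> real"
  assumes g: "\<And>y. (g has_real_derivative g' y) (at y)"
    and g': "\<And>y. (g' has_real_derivative g'' y) (at y)"
    and cont: "continuous_on UNIV g''" and bdd: "bounded (range g'')"
    and int: "integrable lborel (\<lambda>y. exp (g y))"
    and int_sq: "integrable lborel (\<lambda>y. (g' y)\<^sup>2 * exp (g y))"
  shows "(\<integral>y. g'' y * exp (g y) \<partial>lborel) = - (\<integral>y. (g' y)\<^sup>2 * exp (g y) \<partial>lborel)"
proof -
  have cont_g: "continuous_on UNIV g" and cont_g': "continuous_on UNIV g'"
    using g g' by (auto intro!: continuous_at_imp_continuous_on DERIV_isCont)
  have [measurable]: "g \<in> borel_measurable borel" "g' \<in> borel_measurable borel" "g'' \<in> borel_measurable borel"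
    using cont cont_g cont_g' by (auto intro: borel_measurable_continuous_onI)
  obtain B where B: "\<And>y. \<bar>g'' y\<bar> \<le> B"
    using bdd by (auto simp: bounded_iff)
  have int1: "integrable lborel (\<lambda>y. g'' y * exp (g y))"
  proof (rule Bochner_Integration.integrable_bound)
    show "integrable lborel (\<lambda>y. B * exp (g y))" using int by simp
    have "\<bar>g'' y\<bar> \<le> \<bar>B\<bar>" for y using B[of y] by linarith
    then show "AE y in lborel. norm (g'' y * exp (g y)) \<le> norm (B * exp (g y))"
      by (simp add: abs_mult)
  qed simp
  have int2: "integrable lborel (\<lambda>y. g' y * exp (g y))"
  proof (rule Bochner_Integration.integrable_bound)
    show "integrable lborel (\<lambda>y. exp (g y) + (g' y)\<^sup>2 * exp (g y))" using int int_sq by simp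
    \<comment> \<open>This dominates the derivative of \<open>exp g\<close> by the two integrable
      functions \<open>exp g\<close> and \<open>g'\<close> squared times
      \<open>exp g\<close>.\<close>
    have "\<bar>x\<bar> \<le> 1 + x\<^sup>2" for x :: real
      using zero_le_power2[of "\<bar>x\<bar> - 1"] unfolding power2_diff by simp
    then have "\<bar>g' y\<bar> * exp (g y) \<le> (1 + (g' y)\<^sup>2) * exp (g y)" for y
      by (intro mult_right_mono) auto
    then show "AE y in lborel. norm (g' y * exp (g y)) \<le> norm (exp (g y) + (g' y)\<^sup>2 * exp (g y))"
      by (simp add: abs_mult algebra_simps)
  qed simp
  have "(\<integral>y. g'' y * exp (g y) + (g' y)\<^sup>2 * exp (g y) \<partial>lborel) = 0"
  proof (rule integral_deriv_eq_0)
    show "((\<lambda>y. g' y * exp (g y)) has_real_derivative g'' y * exp (g y) + (g' y)\<^sup>2 * exp (g y)) (at y)" for y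
      by (auto intro!: derivative_eq_intros g g' simp: power2_eq_square)
    show "continuous_on UNIV (\<lambda>y. g'' y * exp (g y) + (g' y)\<^sup>2 * exp (g y))"
      by (intro continuous_intros cont cont_g cont_g')
  qed (use int1 int2 int_sq in auto)
  then show ?thesis using int1 int_sq by simp
qed

text \<open>\<open>deriv\<close> is meaningful only where a derivative exists. Composing the Frechet
  derivatives with the line through \<open>(x, y)\<close> in direction \<open>(0, 1)\<close> shows
  that the nested \<open>deriv\<close> in \<open>partial_snd\<close> are genuine.\<close>

lemma twice_cont_differentiable_section:
  fixes f :: "real \<times> real \<Rightarrow> real" and x :: real
  assumes "twice_cont_differentiable f"
  defines "g \<equiv> \<lambda>y. f (x, y)"
  shows "(g has_real_derivative deriv g y) (at y)"
    and "(deriv g has_real_derivative deriv (deriv g) y) (at y)"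
    and "continuous_on UNIV (deriv (deriv g))"
proof -
  obtain f' :: "real \<times> real \<Rightarrow> (real \<times> real) \<Rightarrow>\<^sub>L real"
    and f'' :: "real \<times> real \<Rightarrow> (real \<times> real) \<Rightarrow>\<^sub>L ((real \<times> real) \<Rightarrow>\<^sub>L real)"
    where f': "\<And>z. (f has_derivative blinfun_apply (f' z)) (at z)"
      and f'': "\<And>z. (f' has_derivative blinfun_apply (f'' z)) (at z)"
      and cont: "continuous_on UNIV f''"
    using assms(1) unfolding twice_cont_differentiable_def by blast
  have line: "((\<lambda>y. (x, y)) has_derivative (\<lambda>h. (0, h))) (at y)" for y
    by (auto intro!: derivative_eq_intros)
  \<comment> \<open>The codomain is left general so that the rule serves both \<open>f'\<close> and
    the operator-valued \<open>f''\<close>.\<close>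
  have scale: "(\<lambda>h. blinfun_apply A (0, h)) = (\<lambda>h. h *\<^sub>R blinfun_apply A (0, 1))"
    for A :: "(real \<times> real) \<Rightarrow>\<^sub>L 'c::real_normed_vector"
  proof
    fix h :: real
    show "blinfun_apply A (0, h) = h *\<^sub>R blinfun_apply A (0, 1)"
      using blinfun.scaleR_right[of A h "(0, 1)"] by simp
  qed
  have d1: "(g has_real_derivative blinfun_apply (f' (x, y)) (0, 1)) (at y)" for y
    using has_derivative_compose[OF line f', of y]
    unfolding g_def has_field_derivative_def scale by (simp add: mult_commute_abs)
  then have dg: "deriv g = (\<lambda>y. blinfun_apply (f' (x, y)) (0, 1))"
    by (auto intro!: DERIV_imp_deriv)
  have d2: "(deriv g has_real_derivative blinfun_apply (blinfun_apply (f'' (x, y)) (0, 1)) (0, 1)) (at y)" for y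
  proof -
    have "((\<lambda>y. f' (x, y)) has_derivative (\<lambda>h. h *\<^sub>R blinfun_apply (f'' (x, y)) (0, 1))) (at y)"
      using has_derivative_compose[OF line f'', of y]
      unfolding scale .
    then have "((\<lambda>y. blinfun_apply (f' (x, y)) (0, 1)) has_derivative
        (\<lambda>h. blinfun_apply (h *\<^sub>R blinfun_apply (f'' (x, y)) (0, 1)) (0, 1))) (at y)"
      by (auto intro!: derivative_eq_intros)
    then show ?thesis
      unfolding dg has_field_derivative_def by (simp add: blinfun.scaleR_left mult_commute_abs)
  qed
  then have ddg: "deriv (deriv g) = (\<lambda>y. blinfun_apply (blinfun_apply (f'' (x, y)) (0, 1)) (0, 1))"
    by (auto intro!: DERIV_imp_deriv)
  show "(g has_real_derivative deriv g y) (at y)" using d1 dg by simp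
  show "(deriv g has_real_derivative deriv (deriv g) y) (at y)" using d2 ddg by simp
  have "continuous_on UNIV (\<lambda>y. f'' (x, y))"
    by (rule continuous_on_compose2[OF cont]) (auto intro!: continuous_intros)
  then show "continuous_on UNIV (deriv (deriv g))"
    unfolding ddg by (intro continuous_intros)
qed

section \<open>Time-independent models\<close>

text \<open>The equality set is closed, and a closed set of full Lebesgue measure is the whole
  line.\<close>

lemma AE_lborel_eq_imp_eq:
  fixes f g :: "real \<Rightarrow> real"
  assumes ae: "AE y in lborel. f y = g y" and cont: "continuous_on UNIV (\<lambda>y. f y - g y)"
  shows "f y = g y"
proof -
  have "closed {y. f y - g y = 0}"
    using cont by (intro closed_Collect_eq) (auto intro: continuous_intros)
  moreover have "AE y in lebesgue. y \<in> {y. f y - g y = 0}"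
    using AE_completion[OF ae] by simp
  ultimately have "y \<in> {y. f y - g y = 0}" by (rule mem_closed_if_AE_lebesgue)
  then show ?thesis by simp
qed

lemma partial_snd_snd_only: "partial_snd (\<lambda>(x, y). f y) = (\<lambda>(x, y). deriv f y)"
  by (simp add: partial_snd_def)

lemma on_path_snd_only: "on_path t (\<lambda>(x, y). f y) = (\<lambda>x. f (x t))"
  by (auto simp: on_path_def)

section \<open>Reduction to functions of one coordinate\<close>

locale time_independent_model = feynman_kac_model M1 m1 M m G
  for M1 :: "real measure" and m1 :: "real \<Rightarrow> real"
    and M :: "nat \<Rightarrow> real \<Rightarrow> real measure" and m :: "nat \<Rightarrow> real \<Rightarrow> real \<Rightarrow> real"
    and G :: "nat \<Rightarrow> real \<Rightarrow> real" +
  fixes \<l> :: "nat \<Rightarrow> real"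
  assumes scale_pos: "1 \<le> t \<Longrightarrow> 0 < \<l> t"
    and indep: "2 \<le> t \<Longrightarrow> M t x = M t x'"
    and m1_pos: "0 < m1 y"
    and m_pos: "2 \<le> t \<Longrightarrow> 0 < m t x y"
    and smooth: "1 \<le> t \<Longrightarrow> t \<le> T \<Longrightarrow> twice_cont_differentiable (log_weight m1 m G T t)"
    and second_deriv_bounded: "1 \<le> t \<Longrightarrow> t \<le> T \<Longrightarrow>
      lipschitz_bounded (partial_snd (partial_snd (log_weight m1 m G T t)))"
    and fisher_finite: "sup_fisher_info m1 m G \<l> < \<infinity>"
begin

text \<open>The horizon is set to \<open>t\<close> itself, so the convention at
  \<open>t = T + 1\<close> is not triggered. The argument 0 is an arbitrary representative, since
  the previous state turns out to be immaterial.\<close>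

definition log_factor :: "nat \<Rightarrow> real \<Rightarrow> real"
  where "log_factor t y = log_weight m1 m G t t (0, y)"

lemma log_factor_deriv:
  assumes "1 \<le> t"
  shows "(log_factor t has_real_derivative deriv (log_factor t) y) (at y)"
    and "(deriv (log_factor t) has_real_derivative deriv (deriv (log_factor t)) y) (at y)"
    and "continuous_on UNIV (deriv (deriv (log_factor t)))"
  using twice_cont_differentiable_section[OF smooth[OF assms order_refl], of 0]
  unfolding log_factor_def by auto

lemma log_factor_measurable [measurable]:
  assumes "1 \<le> t"
  shows "log_factor t \<in> borel_measurable borel" "deriv (log_factor t) \<in> borel_measurable borel"
    "deriv (deriv (log_factor t)) \<in> borel_measurable borel"
  using log_factor_deriv[OF assms]
  by (auto intro!: borel_measurable_continuous_onI continuous_at_imp_continuous_on DERIV_isCont)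

text \<open>Equality of the kernels gives equality of densities only almost everywhere. Continuity
  of the log weights upgrades it to every point, and positivity allows \<open>ln\<close> to be
  removed.\<close>

lemma trans_density_const:
  assumes t: "2 \<le> t"
  shows "m t x y = m t 0 y"
proof -
  have [measurable]: "m t x \<in> borel_measurable borel" for x
    using measurable_compose[OF measurable_Pair1'[of x borel borel] trans_measurable[OF t]] by simp
  have "AE y in lborel. ennreal (m t x y) = ennreal (m t 0 y)"
    using trans_density[OF t, of x] trans_density[OF t, of 0] indep[OF t, of x 0]
    by (intro sigma_finite_measure.density_unique[OF lborel.sigma_finite_measure_axioms]) auto
  then have "AE y in lborel. ln (m t x y) = ln (m t 0 y)"
    by eventually_elim (simp add: trans_nonneg t)
  \<comment> \<open>The term \<open>ln (G t y)\<close> cancels in the difference of two sections of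
    \<open>log_weight\<close>, so no separate continuity of \<open>G\<close> enters.\<close>
  moreover have "continuous_on UNIV (\<lambda>y. ln (m t x y) - ln (m t 0 y))"
  proof -
    have "continuous_on UNIV (\<lambda>y. log_weight m1 m G t t (x, y))" for x
      using twice_cont_differentiable_section(1)[OF smooth[of t t], of x] t
      by (auto intro!: continuous_at_imp_continuous_on DERIV_isCont)
    from continuous_on_diff[OF this this, of x 0] show ?thesis
      using t by (simp add: log_weight_def)
  qed
  ultimately have "ln (m t x y) = ln (m t 0 y)" by (rule AE_lborel_eq_imp_eq)
  then show ?thesis using m_pos[OF t] by simp
qed

lemma log_weight_eq:
  assumes "1 \<le> t" "t \<le> T"
  shows "log_weight m1 m G T t = (\<lambda>(x, y). log_factor t y)"
proof -
  have "log_weight m1 m G T t (x, y) = log_factor t y" for x y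
    using assms trans_density_const[of t x y] by (cases "t = 1") (simp_all add: log_weight_def log_factor_def)
  then show ?thesis by auto
qed

lemma partial_snd_log_weight:
  assumes "1 \<le> t" "t \<le> T"
  shows "partial_snd (log_weight m1 m G T t) = (\<lambda>(x, y). deriv (log_factor t) y)"
  by (simp add: log_weight_eq[OF assms] partial_snd_def)

text \<open>At \<open>t = T\<close> this is the convention for the weight at \<open>T + 1\<close>;
  at \<open>t < T\<close> it is independence over time. It is the reason why all \<open>W\<close>
  degenerate to 0.\<close>

lemma partial_fst_log_weight:
  assumes "1 \<le> t" "t \<le> T"
  shows "partial_fst (log_weight m1 m G T (t + 1)) = (\<lambda>_. 0)"
proof (cases "t = T")
  case True
  then show ?thesis by (auto simp: log_weight_def partial_fst_def fun_eq_iff)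
next
  case False
  then show ?thesis using assms log_weight_eq[of "t + 1" T] by (auto simp: partial_fst_def fun_eq_iff)
qed

lemma bounded_second_deriv: "1 \<le> t \<Longrightarrow> bounded (range (deriv (deriv (log_factor t))))"
proof -
  assume t: "1 \<le> t"
  have "bounded (range (partial_snd (\<lambda>(x, y). deriv (log_factor t) y)))"
    using second_deriv_bounded[OF t order_refl]
    unfolding lipschitz_bounded_def partial_snd_log_weight[OF t order_refl] by blast
  moreover have "range (deriv (deriv (log_factor t))) \<subseteq> range (partial_snd (\<lambda>(x, y). deriv (log_factor t) y))"
    by (auto simp: partial_snd_def image_def)
  ultimately show ?thesis by (rule bounded_subset)
qed

section \<open>Product form and marginals of the target\<close>

lemma target_unnorm_eq:
  assumes "1 \<le> T"
  shows "target_unnorm m1 m G T x = (\<Prod>t=1..T. exp (log_factor t (x t)))"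
proof -
  have 1: "m1 (x 1) * G 1 (x 1) = exp (log_factor 1 (x 1))"
    using m1_pos potential_pos[of 1] by (simp add: log_factor_def log_weight_def exp_add)
  have "m t (x (t - 1)) (x t) * G t (x t) = exp (log_factor t (x t))" if "t \<in> {2..T}" for t
    using that m_pos[of t 0 "x t"] potential_pos[of t "x t"] trans_density_const[of t "x (t - 1)" "x t"]
    by (simp add: log_factor_def log_weight_def exp_add)
  then have "target_unnorm m1 m G T x = exp (log_factor 1 (x 1)) * (\<Prod>t=2..T. exp (log_factor t (x t)))"
    unfolding target_unnorm_def 1 by (intro arg_cong2[where f="(*)"] prod.cong) auto
  also have "{1..T} = insert 1 {2..T}" using assms by auto
  then have "exp (log_factor 1 (x 1)) * (\<Prod>t=2..T. exp (log_factor t (x t))) = (\<Prod>t=1..T. exp (log_factor t (x t)))"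
    by simp
  finally show ?thesis .
qed

definition target_norm :: "nat \<Rightarrow> real"
  where "target_norm T = (\<integral>x. target_unnorm m1 m G T x \<partial>(\<Pi>\<^sub>M t\<in>{1..T}. lborel))"

lemma target_density_eq:
  "1 \<le> T \<Longrightarrow> target_density m1 m G T x = (\<Prod>t=1..T. exp (log_factor t (x t))) / target_norm T"
  by (simp add: target_density_def target_norm_def target_unnorm_eq)

text \<open>Since division by 0 gives 0, a vanishing constant would make the target the null measure
  rather than a probability measure.\<close>

lemma target_norm_pos:
  assumes T: "1 \<le> T"
  shows "0 < target_norm T"
proof -
  interpret prob_space "target m1 m G T" by (rule target_prob[OF T])
  have "0 \<le> target_norm T"
    unfolding target_norm_def by (intro integral_nonneg_AE) (auto simp: target_unnorm_eq[OF T] prod_nonneg)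
  moreover have "target_norm T \<noteq> 0"
  proof
    assume "target_norm T = 0"
    then have "target m1 m G T = density (\<Pi>\<^sub>M t\<in>{1..T}. lborel) (\<lambda>_. 0)"
      by (simp add: target_def target_density_eq[OF T])
    then have "emeasure (target m1 m G T) (space (target m1 m G T)) = 0"
      by (simp add: emeasure_density)
    then show False using emeasure_space_1 by simp
  qed
  ultimately show ?thesis by simp
qed

lemma coord_measurable:
  "t \<in> I \<Longrightarrow> (\<lambda>x. x t) \<in> borel_measurable (\<Pi>\<^sub>M t\<in>I. (lborel :: real measure))"
  using measurable_component_singleton[of t I "\<lambda>_. lborel :: real measure"] by simp

lemma target_density_measurable [measurable]:
  assumes T: "1 \<le> T"
  shows "target_density m1 m G T \<in> borel_measurable (\<Pi>\<^sub>M t\<in>{1..T}. lborel)"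
proof -
  have "target_density m1 m G T = (\<lambda>x. (\<Prod>t=1..T. exp (log_factor t (x t))) / target_norm T)"
    by (simp add: target_density_eq[OF T] fun_eq_iff)
  moreover have "(\<lambda>x. log_factor t (x t)) \<in> borel_measurable (\<Pi>\<^sub>M t\<in>{1..T}. lborel)" if "t \<in> {1..T}" for t
    using that log_factor_measurable(1)[of t] by (intro measurable_compose[OF coord_measurable]) auto
  ultimately show ?thesis by simp
qed

text \<open>A non-integrable product would have Bochner integral 0, against
  \<open>target_norm_pos\<close>. Tonelli then writes a finite integral as a product of
  one-dimensional ones.\<close>

lemma integrable_exp_log_factor:
  assumes t: "1 \<le> t"
  shows "integrable lborel (\<lambda>y. exp (log_factor t y))"
proof -
  interpret product_sigma_finite "\<lambda>_::nat. lborel :: real measure"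
    by (simp add: product_sigma_finite_def lborel.sigma_finite_measure_axioms)
  have log_factor [measurable]: "log_factor s \<in> borel_measurable borel" if "s \<in> {1..t}" for s
    using log_factor_measurable(1)[of s] that by simp
  have "integrable (\<Pi>\<^sub>M s\<in>{1..t}. lborel) (target_unnorm m1 m G t)"
  proof (rule ccontr)
    assume "\<not> ?thesis"
    then have "target_norm t = 0" unfolding target_norm_def by (rule not_integrable_integral_eq)
    then show False using target_norm_pos[OF t] by simp
  qed
  then have "(\<integral>\<^sup>+x. (\<Prod>s=1..t. ennreal (exp (log_factor s (x s)))) \<partial>(\<Pi>\<^sub>M s\<in>{1..t}. lborel)) < \<infinity>"
    unfolding integrable_iff_bounded target_unnorm_eq[OF t]
    by (simp add: prod_ennreal abs_prod)
  then have "(\<Prod>s=1..t. \<integral>\<^sup>+y. ennreal (exp (log_factor s y)) \<partial>lborel) < \<infinity>"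
    by (subst (asm) product_nn_integral_prod) auto
  \<comment> \<open>In \<open>ennreal\<close> zero times infinity is 0, so finiteness of the product
    passes to a factor only if no other factor vanishes.\<close>
  moreover have "(\<integral>\<^sup>+y. ennreal (exp (log_factor s y)) \<partial>lborel) \<noteq> 0" if "s \<in> {1..t}" for s
    using log_factor[OF that] by (subst nn_integral_0_iff_AE) (auto simp: eventually_False ae_filter_eq_bot_iff)
  ultimately have "(\<integral>\<^sup>+y. ennreal (exp (log_factor t y)) \<partial>lborel) < \<infinity>"
    using t by (auto simp: ennreal_prod_eq_top top.not_eq_extremum[symmetric])
  then show ?thesis using log_factor[of t] t by (intro integrableI_bounded) auto
qed

definition factor_norm :: "nat \<Rightarrow> real" where "factor_norm t = (\<integral>y. exp (log_factor t y) \<partial>lborel)"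

lemma nn_integral_exp_log_factor: "1 \<le> t \<Longrightarrow> (\<integral>\<^sup>+y. ennreal (exp (log_factor t y)) \<partial>lborel) = ennreal (factor_norm t)"
  unfolding factor_norm_def by (intro nn_integral_eq_integral integrable_exp_log_factor) auto

lemma factor_norm_pos: "1 \<le> t \<Longrightarrow> 0 < factor_norm t"
proof -
  assume t: "1 \<le> t"
  have [measurable]: "log_factor t \<in> borel_measurable borel" using log_factor_measurable(1)[OF t] .
  have "ennreal (factor_norm t) \<noteq> 0"
    unfolding nn_integral_exp_log_factor[OF t, symmetric]
    by (subst nn_integral_0_iff_AE) (auto simp: eventually_False ae_filter_eq_bot_iff)
  then show ?thesis by (simp add: ennreal_eq_0_iff)
qed

lemma target_norm_eq:
  assumes "1 \<le> T"
  shows "target_norm T = (\<Prod>t=1..T. factor_norm t)"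
proof -
  interpret product_sigma_finite "\<lambda>_::nat. lborel :: real measure"
    by (simp add: product_sigma_finite_def lborel.sigma_finite_measure_axioms)
  show ?thesis
    unfolding target_norm_def factor_norm_def target_unnorm_eq[OF assms]
    by (rule product_integral_prod) (auto intro: integrable_exp_log_factor)
qed

definition marginal :: "nat \<Rightarrow> real measure"
  where "marginal t = density lborel (\<lambda>y. ennreal (exp (log_factor t y) / factor_norm t))"

text \<open>The indicator of \<open>A\<close> is absorbed into the factor at time \<open>t\<close>;
  Tonelli splits the integral, and all other normalised factors integrate to 1.\<close>

lemma distr_target:
  assumes t: "1 \<le> t" "t \<le> T"
  shows "distr (target m1 m G T) borel (\<lambda>x. x t) = marginal t"
proof (rule measure_eqI)
  have T: "1 \<le> T" using t by simp
  interpret product_sigma_finite "\<lambda>_::nat. lborel :: real measure"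
    by (simp add: product_sigma_finite_def lborel.sigma_finite_measure_axioms)
  have log_factor [measurable]: "log_factor s \<in> borel_measurable borel" if "s \<in> {1..T}" for s
    using log_factor_measurable(1)[of s] that by simp
  have [measurable]: "(\<lambda>x. x t) \<in> borel_measurable (\<Pi>\<^sub>M s\<in>{1..T}. (lborel :: real measure))"
    using t by (intro coord_measurable) simp

  fix A assume "A \<in> sets (distr (target m1 m G T) borel (\<lambda>x. x t))"
  then have A [measurable]: "A \<in> sets borel" by simp
  let ?P = "\<Pi>\<^sub>M s\<in>{1..T}. (lborel :: real measure)"
  let ?f = "\<lambda>s y. ennreal (exp (log_factor s y) / factor_norm s) * (if s = t then indicator A y else 1)"
  have "emeasure (distr (target m1 m G T) borel (\<lambda>x. x t)) A =
      emeasure (target m1 m G T) ((\<lambda>x. x t) -` A \<inter> space ?P)"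
  proof -
    have "(\<lambda>x. x t) \<in> target m1 m G T \<rightarrow>\<^sub>M borel"
      unfolding target_def measurable_density_eq1 by measurable
    then show ?thesis by (simp add: emeasure_distr) (simp add: target_def)
  qed
  also have "\<dots> = (\<integral>\<^sup>+x. ennreal (target_density m1 m G T x) * indicator ((\<lambda>x. x t) -` A \<inter> space ?P) x \<partial>?P)"
    unfolding target_def
  proof (rule emeasure_density)
    show "(\<lambda>x. ennreal (target_density m1 m G T x)) \<in> borel_measurable ?P"
      using target_density_measurable[OF T] by (rule measurable_compose) simp
  qed measurable
  also have "\<dots> = (\<integral>\<^sup>+x. (\<Prod>s\<in>{1..T}. ?f s (x s)) \<partial>?P)"
  proof (rule nn_integral_cong)
    fix x assume x: "x \<in> space ?P"
    have "ennreal (target_density m1 m G T x) = (\<Prod>s=1..T. ennreal (exp (log_factor s (x s)) / factor_norm s))"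
      using factor_norm_pos by (subst prod_ennreal) (auto simp: target_density_eq[OF T] target_norm_eq[OF T] prod_dividef less_imp_le)
    moreover have "(\<Prod>s\<in>{1..T}. if s = t then indicator A (x s) else 1) =
        (indicator ((\<lambda>x. x t) -` A \<inter> space ?P) x :: ennreal)"
      using t x by (simp add: prod.delta indicator_def)
    ultimately show "ennreal (target_density m1 m G T x) * indicator ((\<lambda>x. x t) -` A \<inter> space ?P) x =
        (\<Prod>s\<in>{1..T}. ?f s (x s))"
      by (simp only: prod.distrib)
  qed
  also have "\<dots> = (\<Prod>s\<in>{1..T}. \<integral>\<^sup>+y. ?f s y \<partial>lborel)"
    by (rule product_nn_integral_prod) auto
  also have "\<dots> = (\<Prod>s\<in>{1..T}. if s = t then emeasure (marginal t) A else 1)"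
  proof (rule prod.cong)
    fix s assume s: "s \<in> {1..T}"
    have "(\<integral>\<^sup>+y. ennreal (exp (log_factor s y) / factor_norm s) \<partial>lborel) = ennreal ((\<integral>y. exp (log_factor s y) / factor_norm s \<partial>lborel))"
      using s factor_norm_pos[of s] by (intro nn_integral_eq_integral integrable_divide_zero integrable_exp_log_factor) auto
    also have "\<dots> = 1" using s factor_norm_pos[of s] by (simp add: factor_norm_def)
    finally have "(\<integral>\<^sup>+y. ennreal (exp (log_factor s y) / factor_norm s) \<partial>lborel) = 1" .
    then show "(\<integral>\<^sup>+y. ?f s y \<partial>lborel) = (if s = t then emeasure (marginal t) A else 1)"
      using s log_factor[OF s] by (auto simp: marginal_def emeasure_density)
  qed simp
  also have "\<dots> = emeasure (marginal t) A" using t by (simp add: prod.delta)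
  finally show "emeasure (distr (target m1 m G T) borel (\<lambda>x. x t)) A = emeasure (marginal t) A" .
qed (simp add: marginal_def)

lemma integral_target:
  fixes f :: "real \<Rightarrow> real"
  assumes t: "1 \<le> t" "t \<le> T" and f: "f \<in> borel_measurable borel"
  shows "(\<integral>x. f (x t) \<partial>target m1 m G T) = (\<integral>y. f y \<partial>marginal t)"
    and "(\<integral>\<^sup>+x. ennreal (f (x t)) \<partial>target m1 m G T) = (\<integral>\<^sup>+y. ennreal (f y) \<partial>marginal t)"
proof -
  have "(\<lambda>x. x t) \<in> borel_measurable (\<Pi>\<^sub>M s\<in>{1..T}. (lborel :: real measure))"
    using t by (intro coord_measurable) simp
  then have *: "(\<lambda>x. x t) \<in> target m1 m G T \<rightarrow>\<^sub>M borel"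
    unfolding target_def measurable_density_eq1 .
  show "(\<integral>x. f (x t) \<partial>target m1 m G T) = (\<integral>y. f y \<partial>marginal t)"
    unfolding distr_target[OF t, symmetric] by (subst integral_distr[OF * f]) simp
  show "(\<integral>\<^sup>+x. ennreal (f (x t)) \<partial>target m1 m G T) = (\<integral>\<^sup>+y. ennreal (f y) \<partial>marginal t)"
    unfolding distr_target[OF t, symmetric] using f by (subst nn_integral_distr[OF *]) simp_all
qed

section \<open>Fisher information and moments of the Gaussian weights\<close>

lemma partial_coord_log_target:
  assumes t: "1 \<le> t" "t \<le> T"
  shows "partial_coord t (\<lambda>x. ln (target_density m1 m G T x)) x = deriv (log_factor t) (x t)"
proof -
  have T: "1 \<le> T" using t by simp
  have ln: "ln (target_density m1 m G T x) = (\<Sum>s=1..T. log_factor s (x s)) - ln (target_norm T)" for x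
    using target_norm_pos[OF T] by (simp add: target_density_eq[OF T] ln_div ln_prod prod_pos)
  \<comment> \<open>Isolating the summand at \<open>t\<close> leaves a remainder constant in
    \<open>u\<close>, so the score does not depend on the horizon \<open>T\<close>.\<close>
  have "(\<Sum>s=1..T. log_factor s ((x(t := u)) s)) = log_factor t u + (\<Sum>s\<in>{1..T} - {t}. log_factor s (x s))" for u
    using t by (subst sum.remove[of _ t]) auto
  then have "((\<lambda>u. ln (target_density m1 m G T (x(t := u)))) has_real_derivative deriv (log_factor t) (x t)) (at (x t))"
    unfolding ln by (auto intro!: derivative_eq_intros log_factor_deriv(1) t)
  then show ?thesis unfolding partial_coord_def by (rule DERIV_imp_deriv)
qed

lemma fisher_info_eq:
  assumes t: "1 \<le> t" "t \<le> T"
  shows "fisher_info m1 m G T t = (\<integral>\<^sup>+y. ennreal ((deriv (log_factor t) y)\<^sup>2) \<partial>marginal t)"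
  unfolding fisher_info_def partial_coord_log_target[OF t]
  using log_factor_measurable(2)[OF t(1)] by (intro integral_target(2)[OF t]) simp

definition fisher :: "nat \<Rightarrow> real"
  where "fisher t = (\<integral>y. (deriv (log_factor t) y)\<^sup>2 \<partial>marginal t)"

lemma scaled_fisher_info_le:
  assumes "1 \<le> t" "t \<le> T"
  shows "ennreal (\<l> t) * fisher_info m1 m G T t \<le> sup_fisher_info m1 m G \<l>"
  unfolding sup_fisher_info_def using assms by (intro SUP_upper2[of T] SUP_upper2[of t]) auto

text \<open>The finite supremum, read at the horizon \<open>T = t\<close>, bounds the scaled
  information; as the scale is positive, the information itself is finite. This permits the passage
  from \<open>ennreal\<close> to the real number \<open>fisher t\<close>.\<close>

lemma
  assumes t: "1 \<le> t"
  shows integrable_score_sq: "integrable (marginal t) (\<lambda>y. (deriv (log_factor t) y)\<^sup>2)"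
    and scaled_fisher_nonneg: "0 \<le> \<l> t * fisher t"
    and scaled_fisher_le: "\<l> t * fisher t \<le> enn2real (sup_fisher_info m1 m G \<l>)"
proof -
  have [measurable]: "deriv (log_factor t) \<in> borel_measurable borel" using log_factor_measurable(2)[OF t] .
  have "ennreal (\<l> t) * fisher_info m1 m G t t < \<infinity>"
    using scaled_fisher_info_le[OF t order_refl] fisher_finite by (rule le_less_trans)
  then have "fisher_info m1 m G t t < \<infinity>"
    using scale_pos[OF t] by (auto simp: ennreal_mult_less_top)
  then show int: "integrable (marginal t) (\<lambda>y. (deriv (log_factor t) y)\<^sup>2)"
    unfolding fisher_info_eq[OF t order_refl] marginal_def by (intro integrableI_bounded) auto
  have nonneg: "0 \<le> fisher t" unfolding fisher_def by (intro integral_nonneg_AE) simp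
  then show "0 \<le> \<l> t * fisher t" using scale_pos[OF t] by simp
  have "fisher_info m1 m G t t = ennreal (fisher t)"
    unfolding fisher_info_eq[OF t order_refl] fisher_def using int by (intro nn_integral_eq_integral) auto
  then have "ennreal (\<l> t * fisher t) \<le> sup_fisher_info m1 m G \<l>"
    using scaled_fisher_info_le[OF t order_refl] scale_pos[OF t] nonneg by (simp add: ennreal_mult)
  then have "enn2real (ennreal (\<l> t * fisher t)) \<le> enn2real (sup_fisher_info m1 m G \<l>)"
    using fisher_finite by (intro enn2real_mono) auto
  then show "\<l> t * fisher t \<le> enn2real (sup_fisher_info m1 m G \<l>)"
    using nonneg scale_pos[OF t] by simp
qed

text \<open>The Bartlett identity for the unnormalised factor, divided by
  \<open>factor_norm t\<close>.\<close>

lemma integral_second_deriv: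
  assumes t: "1 \<le> t"
  shows "(\<integral>y. deriv (deriv (log_factor t)) y \<partial>marginal t) = - fisher t"
proof -
  note [measurable] = log_factor_measurable[OF t]
  have density: "(\<integral>y. f y \<partial>marginal t) = (\<integral>y. f y * exp (log_factor t y) \<partial>lborel) / factor_norm t"
    if [measurable]: "f \<in> borel_measurable borel" for f
    unfolding marginal_def using factor_norm_pos[OF t]
    by (subst integral_density) (auto simp: mult.commute)
  have "integrable lborel (\<lambda>y. (exp (log_factor t y) / factor_norm t) *\<^sub>R (deriv (log_factor t) y)\<^sup>2)"
    using integrable_score_sq[OF t] factor_norm_pos[OF t] unfolding marginal_def
    by (subst (asm) integrable_density) auto
  then have "integrable lborel (\<lambda>y. factor_norm t * ((exp (log_factor t y) / factor_norm t) *\<^sub>R (deriv (log_factor t) y)\<^sup>2))"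
    by (rule integrable_mult_right)
  then have "integrable lborel (\<lambda>y. (deriv (log_factor t) y)\<^sup>2 * exp (log_factor t y))"
    using factor_norm_pos[OF t] by (simp add: mult.commute)
  then have "(\<integral>y. deriv (deriv (log_factor t)) y * exp (log_factor t y) \<partial>lborel) =
      - (\<integral>y. (deriv (log_factor t) y)\<^sup>2 * exp (log_factor t y) \<partial>lborel)"
    by (intro integral_second_deriv_log_density log_factor_deriv[OF t] bounded_second_deriv[OF t] integrable_exp_log_factor[OF t])
  then show ?thesis unfolding fisher_def by (simp add: density)
qed

text \<open>By the Bartlett identity the mean of \<open>V\<close> is minus half its variance, as
  \<open>Sigma_mat\<close> has unit diagonal.\<close>

lemma VW_mean_Inl:
  assumes t: "1 \<le> t" "t \<le> T"
  shows "VW_mean m1 m G \<l> T t (Inl n) = - (\<l> t * fisher t) / 2"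
  using integral_target(1)[OF t log_factor_measurable(3)[OF t(1)]] integral_second_deriv[OF t(1)]
  by (simp add: VW_mean_def partial_snd_log_weight[OF t] partial_snd_snd_only on_path_snd_only)

lemma VW_mean_Inr:
  assumes t: "1 \<le> t" "t \<le> T"
  shows "VW_mean m1 m G \<l> T t (Inr n) = 0"
proof -
  have "partial_fst (\<lambda>_. 0) = (\<lambda>_. 0)" by (auto simp: partial_fst_def)
  moreover have "on_path s (\<lambda>_. 0) = (\<lambda>_. 0)" for s by (auto simp: on_path_def)
  ultimately show ?thesis
    unfolding VW_mean_def partial_fst_log_weight[OF t] by simp
qed

lemma VW_cov_eq:
  assumes t: "1 \<le> t" "t \<le> T"
  shows "VW_cov m1 m G \<l> T t (Inl n) (Inl k) = \<l> t * fisher t * Sigma_mat n k"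
    and "VW_cov m1 m G \<l> T t (Inr n) j = 0" and "VW_cov m1 m G \<l> T t j (Inr n) = 0"
proof -
  have "VW_score m1 m G T t (Inl n) x = deriv (log_factor t) (x t)" for n x
    by (simp add: VW_score_def partial_snd_log_weight[OF t] on_path_def)
  moreover have "(\<lambda>y. (deriv (log_factor t) y)\<^sup>2) \<in> borel_measurable borel"
    using log_factor_measurable(2)[OF t(1)] by simp
  ultimately show "VW_cov m1 m G \<l> T t (Inl n) (Inl k) = \<l> t * fisher t * Sigma_mat n k"
    using integral_target(1)[OF t, of "\<lambda>y. (deriv (log_factor t) y)\<^sup>2"]
    by (simp add: VW_cov_def particle_def fisher_def power2_eq_square)
  have "VW_score m1 m G T t (Inr n) x = 0" for n x
    using partial_fst_log_weight[OF t] by (simp add: VW_score_def on_path_def)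
  then show "VW_cov m1 m G \<l> T t (Inr n) j = 0" "VW_cov m1 m G \<l> T t j (Inr n) = 0"
    by (simp_all add: VW_cov_def)
qed

end

section \<open>Limiting acceptance rates\<close>

text \<open>The covariance \<open>v * Sigma_mat\<close> is that of \<open>sqrt (v / 2) * (\<xi> 0 + \<xi> n)\<close> for independent standard
  normal \<open>\<xi> 0, \<dots>, \<xi> N\<close>.\<close>

lemma Sigma_mat_factor:
  assumes "0 \<le> v" "n \<in> {1..N}" "k \<in> {1..N}"
  shows "v * Sigma_mat n k = (\<Sum>j\<in>{0..N}. (if j = 0 \<or> j = n then sqrt (v / 2) else 0) *
    (if j = 0 \<or> j = k then sqrt (v / 2) else 0))"
proof -
  have "(\<Sum>j\<in>{0..N}. (if j = 0 \<or> j = n then sqrt (v / 2) else 0) * (if j = 0 \<or> j = k then sqrt (v / 2) else 0))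
      = (\<Sum>j\<in>{0..N}. (if j = 0 then v / 2 else 0) + (if j = n then (if n = k then v / 2 else 0) else 0))"
    using assms by (intro sum.cong) auto
  also have "\<dots> = v / 2 + (if n = k then v / 2 else 0)"
    using assms by (simp add: sum.distrib)
  finally show ?thesis by (simp add: Sigma_mat_def)
qed

context time_independent_model
begin

section \<open>Law and coordinates of the Gaussian weights\<close>

definition VW_component :: "nat \<Rightarrow> nat \<Rightarrow> nat \<Rightarrow> (nat + nat \<Rightarrow> real) measure"
  where "VW_component N T t =
    gaussian_law ({1..N} <+> {1..N}) (VW_mean m1 m G \<l> T t) (VW_cov m1 m G \<l> T t)"

lemma is_gaussian_VW_component:
  assumes t: "1 \<le> t" "t \<le> T"
  shows "is_gaussian_law ({1..N} <+> {1..N}) (VW_mean m1 m G \<l> T t) (VW_cov m1 m G \<l> T t)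
    (VW_component N T t)"
proof -
  \<comment> \<open>Rows for \<open>V\<close> are those of \<open>Sigma_mat_factor\<close>; rows for
    \<open>W\<close> are 0 because its covariances vanish.\<close>
  define B :: "nat + nat \<Rightarrow> nat \<Rightarrow> real" where
    "B i j = (case i of Inl n \<Rightarrow> if j = 0 \<or> j = n then sqrt (\<l> t * fisher t / 2) else 0 | Inr n \<Rightarrow> 0)" for i j
  have "VW_cov m1 m G \<l> T t i k = (\<Sum>j\<in>{0..N}. B i j * B k j)"
    if "i \<in> {1..N} <+> {1..N}" "k \<in> {1..N} <+> {1..N}" for i k
    using that Sigma_mat_factor[OF scaled_fisher_nonneg[OF t(1)], of _ N]
    by (auto simp: B_def VW_cov_eq[OF t] simp del: One_nat_def)
  then have "\<exists>P. is_gaussian_law ({1..N} <+> {1..N}) (VW_mean m1 m G \<l> T t) (VW_cov m1 m G \<l> T t) P"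
    by (intro is_gaussian_law_exists[where B=B and J="{0..N}"]) auto
  then show ?thesis unfolding VW_component_def gaussian_law_def by (rule someI_ex)
qed

lemma prob_space_VW_component: "1 \<le> t \<Longrightarrow> t \<le> T \<Longrightarrow> prob_space (VW_component N T t)"
  and sets_VW_component: "1 \<le> t \<Longrightarrow> t \<le> T \<Longrightarrow>
    sets (VW_component N T t) = sets (\<Pi>\<^sub>M i\<in>{1..N} <+> {1..N}. borel)"
  using is_gaussian_VW_component unfolding is_gaussian_law_def by blast+

lemma VW_law_eq: "VW_law m1 m G \<l> N T = (\<Pi>\<^sub>M t\<in>{1..T}. VW_component N T t)"
  unfolding VW_law_def VW_component_def ..

lemma prob_space_VW_law: "prob_space (VW_law m1 m G \<l> N T)"
  unfolding VW_law_eq by (intro prob_space_PiM prob_space_VW_component) auto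

text \<open>The kernel lemmas require every coordinate to be measurable. Outside the index set a
  coordinate is constantly \<open>undefined\<close> on the space.\<close>

lemma component_coord_measurable:
  assumes t: "1 \<le> t" "t \<le> T"
  shows "(\<lambda>x. x i) \<in> borel_measurable (VW_component N T t)"
proof (cases "i \<in> {1..N} <+> {1..N}")
  case True
  then show ?thesis
    unfolding measurable_cong_sets[OF sets_VW_component[OF t] refl] by (rule measurable_component_singleton)
next
  case False
  have "x i = undefined" if "x \<in> space (VW_component N T t)" for x
    using that False unfolding sets_eq_imp_space_eq[OF sets_VW_component[OF t]] space_PiM
    by (auto simp: PiE_def extensional_def)
  then have "(\<lambda>x. x i) \<in> borel_measurable (VW_component N T t) \<longleftrightarrow>
      (\<lambda>_. undefined :: real) \<in> borel_measurable (VW_component N T t)"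
    by (intro measurable_cong)
  then show ?thesis by simp
qed

lemma VW_coord_measurable: "(\<lambda>\<omega>. \<omega> t i) \<in> borel_measurable (VW_law m1 m G \<l> N T)"
proof (cases "t \<in> {1..T}")
  case True
  then show ?thesis
    unfolding VW_law_eq
    by (intro measurable_compose[OF measurable_component_singleton[OF True] component_coord_measurable]) auto
next
  case False
  have "\<omega> t = undefined" if "\<omega> \<in> space (VW_law m1 m G \<l> N T)" for \<omega>
    using that False unfolding VW_law_eq space_PiM by (auto simp: PiE_def extensional_def)
  then have "(\<lambda>\<omega>. \<omega> t i) \<in> borel_measurable (VW_law m1 m G \<l> N T) \<longleftrightarrow>
      (\<lambda>_. undefined i :: real) \<in> borel_measurable (VW_law m1 m G \<l> N T)"
    by (intro measurable_cong) simp
  then show ?thesis by simp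
qed

text \<open>Each coordinate of \<open>W\<close> has mean and variance 0, and there are finitely
  many; time 0 and index 0 vanish by the definition of \<open>W_of\<close>.\<close>

lemma AE_W_eq_0: "AE \<omega> in VW_law m1 m G \<l> N T. \<forall>u\<le>T. \<forall>l\<le>N. W_of \<omega> u l = 0"
proof -
  have "AE \<omega> in VW_law m1 m G \<l> N T. \<omega> u (Inr l) = 0" if u: "u \<in> {1..T}" and l: "l \<in> {1..N}" for u l
  proof -
    have u': "1 \<le> u" "u \<le> T" using u by auto
    have "distr (VW_component N T u) borel (\<lambda>x. x (Inr l)) = normal_law 0 0"
      using is_gaussian_law_marginal[OF is_gaussian_VW_component[OF u', of N] _ InrI[OF l]]
      by (simp add: VW_mean_Inr[OF u'] VW_cov_eq[OF u'])
    then have "AE x in distr (VW_component N T u) borel (\<lambda>x. x (Inr l)). x = 0"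
      using AE_normal_law_degenerate[of 0] by (simp only:)
    then have "AE x in VW_component N T u. x (Inr l) = 0"
      by (rule AE_distrD[OF component_coord_measurable[OF u']])
    then show ?thesis
      unfolding VW_law_eq using u by (intro AE_PiM_component prob_space_VW_component) auto
  qed
  then have "AE \<omega> in VW_law m1 m G \<l> N T. \<forall>u\<in>{1..T}. \<forall>l\<in>{1..N}. \<omega> u (Inr l) = 0"
    by (intro AE_finite_allI) auto
  then show ?thesis by eventually_elim (auto simp: W_of_def)
qed

section \<open>Averaging over the Gaussian weights\<close>

lemma acceptance_rate_eq:
  "acceptance_rate m1 m G \<l> forced backward N T t =
    (\<integral>\<omega>. measure_pmf.prob (indices_pmf forced backward N T \<omega>) {(A, K). K t \<noteq> 0} \<partial>VW_law m1 m G \<l> N T)"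
proof -
  interpret prob_space "VW_law m1 m G \<l> N T" by (rule prob_space_VW_law)
  have "(\<lambda>\<omega>. measure_pmf (indices_pmf forced backward N T \<omega>))
      \<in> VW_law m1 m G \<l> N T \<rightarrow>\<^sub>M subprob_algebra (count_space UNIV)"
    by (intro finite_pmf_kernel_measurable indices_kernel VW_coord_measurable)
  then show ?thesis
    unfolding acceptance_rate_def limit_law_def by (rule measure_bind) simp
qed

lemma acceptance_rate_ge:
  assumes meas: "f \<in> borel_measurable (VW_law m1 m G \<l> N T)"
    and bound: "\<And>\<omega>. 0 \<le> f \<omega> \<and> f \<omega> \<le> 1"
    and le: "\<And>\<omega>. (\<And>u l. u \<le> T \<Longrightarrow> l \<le> N \<Longrightarrow> W_of \<omega> u l = 0) \<Longrightarrow>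
      f \<omega> \<le> measure_pmf.prob (indices_pmf forced backward N T \<omega>) {(A, K). K t \<noteq> 0}"
  shows "(\<integral>\<omega>. f \<omega> \<partial>VW_law m1 m G \<l> N T) \<le> acceptance_rate m1 m G \<l> forced backward N T t"
  unfolding acceptance_rate_eq
proof (rule integral_mono_AE)
  interpret prob_space "VW_law m1 m G \<l> N T" by (rule prob_space_VW_law)
  show "integrable (VW_law m1 m G \<l> N T) f"
    using meas bound by (intro integrable_const_bound[where B=1]) auto
  have "(\<lambda>\<omega>. measure_pmf (indices_pmf forced backward N T \<omega>))
      \<in> VW_law m1 m G \<l> N T \<rightarrow>\<^sub>M subprob_algebra (count_space UNIV)"
    by (intro finite_pmf_kernel_measurable indices_kernel VW_coord_measurable)
  then have "(\<lambda>\<omega>. measure_pmf.prob (indices_pmf forced backward N T \<omega>) {(A, K). K t \<noteq> 0})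
      \<in> borel_measurable (VW_law m1 m G \<l> N T)"
    by (rule measurable_compose) (auto intro: measurable_measure_subprob_algebra)
  then show "integrable (VW_law m1 m G \<l> N T)
      (\<lambda>\<omega>. measure_pmf.prob (indices_pmf forced backward N T \<omega>) {(A, K). K t \<noteq> 0})"
    by (intro integrable_const_bound[where B=1]) auto
  show "AE \<omega> in VW_law m1 m G \<l> N T.
      f \<omega> \<le> measure_pmf.prob (indices_pmf forced backward N T \<omega>) {(A, K). K t \<noteq> 0}"
    using AE_W_eq_0 by eventually_elim (rule le, blast)
qed

text \<open>Stated on a single component of \<open>\<omega>\<close>, so that the product structure
  of \<open>VW_law\<close> applies.\<close>

definition accept :: "nat \<Rightarrow> (nat + nat \<Rightarrow> real) \<Rightarrow> real"
  where "accept N x = 1 - Psi N (\<lambda>k. x (Inl k)) 0"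

lemma accept_V_of: "1 - Psi N (V_of \<omega> t) 0 = accept N (\<omega> t)"
  unfolding accept_def Psi_def V_of_def by (auto intro!: arg_cong2[where f="(/)"] sum.cong)

lemma accept_bounds: "0 \<le> accept N x" "accept N x \<le> 1"
  unfolding accept_def by (rule one_minus_Psi_zero_bounds)+

lemma accept_measurable:
  "1 \<le> t \<Longrightarrow> t \<le> T \<Longrightarrow> accept N \<in> borel_measurable (VW_component N T t)"
  unfolding accept_def by (intro borel_measurable_diff Psi_measurable component_coord_measurable) auto

lemma integral_accept_ge:
  assumes N: "1 \<le> N" and t: "1 \<le> t" "t \<le> T"
  shows "inverse (1 + exp (enn2real (sup_fisher_info m1 m G \<l>)) / real N)
    \<le> (\<integral>x. accept N x \<partial>VW_component N T t)"
proof -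
  interpret prob_space "VW_component N T t" by (rule prob_space_VW_component[OF t])
  have "distr (VW_component N T t) borel (\<lambda>x. x (Inl k)) = normal_law (- (\<l> t * fisher t) / 2) (\<l> t * fisher t)"
    if "k \<in> {1..N}" for k
    using is_gaussian_law_marginal[OF is_gaussian_VW_component[OF t, of N] _ InlI[OF that]]
    by (simp add: VW_mean_Inl[OF t] VW_cov_eq[OF t] Sigma_mat_def)
  then have "inverse (1 + exp (\<l> t * fisher t) / real N) \<le> (\<integral>x. accept N x \<partial>VW_component N T t)"
    unfolding accept_def
    by (intro expectation_one_minus_Psi_zero N scaled_fisher_nonneg t component_coord_measurable)
  moreover have "inverse (1 + exp (enn2real (sup_fisher_info m1 m G \<l>)) / real N)
      \<le> inverse (1 + exp (\<l> t * fisher t) / real N)"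
    using scaled_fisher_le[OF t(1)]
    by (intro le_imp_inverse_le add_left_mono divide_right_mono add_pos_nonneg) auto
  ultimately show ?thesis by simp
qed

lemma acceptance_rate_backward_ge:
  assumes N: "1 \<le> N" and t: "1 \<le> t" "t \<le> T"
  shows "inverse (1 + exp (enn2real (sup_fisher_info m1 m G \<l>)) / real N)
    \<le> acceptance_rate m1 m G \<l> forced True N T t"
proof -
  have proj: "(\<lambda>\<omega>. \<omega> t) \<in> VW_law m1 m G \<l> N T \<rightarrow>\<^sub>M VW_component N T t"
    unfolding VW_law_eq using t by (intro measurable_component_singleton) simp
  have "distr (VW_law m1 m G \<l> N T) (VW_component N T t) (\<lambda>\<omega>. \<omega> t) = VW_component N T t"
    unfolding VW_law_eq using t by (intro distr_PiM_component prob_space_VW_component) auto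
  then have "(\<integral>x. accept N x \<partial>VW_component N T t) = (\<integral>\<omega>. accept N (\<omega> t) \<partial>VW_law m1 m G \<l> N T)"
    using integral_distr[OF proj accept_measurable[OF t]] by simp
  moreover have "(\<integral>\<omega>. accept N (\<omega> t) \<partial>VW_law m1 m G \<l> N T) \<le> acceptance_rate m1 m G \<l> forced True N T t"
    using acceptance_backward[of T N _ t forced] t accept_bounds
    by (intro acceptance_rate_ge measurable_compose[OF proj accept_measurable[OF t]]) (auto simp: accept_V_of)
  ultimately show ?thesis using integral_accept_ge[OF N t] by simp
qed

text \<open>Independence of the components turns the mean of the product into a product of means.
  The exponent \<open>T\<close> covers every \<open>t\<close> at once.\<close>

lemma acceptance_rate_no_backward_ge:
  assumes N: "1 \<le> N" and t: "1 \<le> t" "t \<le> T"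
  shows "inverse (1 + exp (enn2real (sup_fisher_info m1 m G \<l>)) / real N) ^ T
    \<le> acceptance_rate m1 m G \<l> forced False N T t"
proof -
  \<comment> \<open>\<open>product_sigma_finite\<close> concerns every index, so the family is
    extended beyond \<open>{1..T}\<close> by point masses.\<close>
  define P where "P u = (if u \<in> {1..T} then VW_component N T u else return (count_space UNIV) undefined)" for u
  have P: "prob_space (P u)" for u
    by (auto simp: P_def intro!: prob_space_VW_component prob_space_return)
  interpret product_sigma_finite P
    using P by (simp add: product_sigma_finite_def prob_space_imp_sigma_finite)
  have VW: "VW_law m1 m G \<l> N T = (\<Pi>\<^sub>M u\<in>{1..T}. P u)"
    unfolding VW_law_eq by (rule PiM_cong) (auto simp: P_def)
  let ?b = "inverse (1 + exp (enn2real (sup_fisher_info m1 m G \<l>)) / real N)"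
  have "integrable (P u) (accept N)" if "u \<in> {1..T}" for u
  proof -
    interpret prob_space "P u" by (rule P)
    show ?thesis
      using that accept_measurable[of u T N] accept_bounds
      by (intro integrable_const_bound[where B=1]) (auto simp: P_def)
  qed
  then have "(\<integral>\<omega>. (\<Prod>u\<in>{1..T}. accept N (\<omega> u)) \<partial>VW_law m1 m G \<l> N T) =
      (\<Prod>u\<in>{1..T}. \<integral>x. accept N x \<partial>P u)"
    unfolding VW by (intro product_integral_prod) auto
  moreover have "(\<Prod>u\<in>{1..T}. ?b) \<le> (\<Prod>u\<in>{1..T}. \<integral>x. accept N x \<partial>P u)"
    using integral_accept_ge[OF N, of _ T] by (intro prod_mono) (auto simp: P_def)
  moreover have "(\<integral>\<omega>. (\<Prod>u\<in>{1..T}. accept N (\<omega> u)) \<partial>VW_law m1 m G \<l> N T)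
      \<le> acceptance_rate m1 m G \<l> forced False N T t"
  proof (rule acceptance_rate_ge)
    have "(\<lambda>\<omega>. accept N (\<omega> u)) \<in> borel_measurable (VW_law m1 m G \<l> N T)" if "u \<in> {1..T}" for u
      unfolding VW_law_eq using that
      by (intro measurable_compose[OF measurable_component_singleton[OF that] accept_measurable]) auto
    then show "(\<lambda>\<omega>. \<Prod>u\<in>{1..T}. accept N (\<omega> u)) \<in> borel_measurable (VW_law m1 m G \<l> N T)"
      by (rule borel_measurable_prod)
  next
    fix \<omega> :: "nat \<Rightarrow> nat + nat \<Rightarrow> real"
    show "0 \<le> (\<Prod>u\<in>{1..T}. accept N (\<omega> u)) \<and> (\<Prod>u\<in>{1..T}. accept N (\<omega> u)) \<le> 1"
      using accept_bounds by (auto intro!: prod_nonneg prod_le_1)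
  next
    fix \<omega> :: "nat \<Rightarrow> nat + nat \<Rightarrow> real"
    assume "\<And>u l. u \<le> T \<Longrightarrow> l \<le> N \<Longrightarrow> W_of \<omega> u l = 0"
    then have "(\<Prod>u\<in>{t..T}. accept N (\<omega> u))
        \<le> measure_pmf.prob (indices_pmf forced False N T \<omega>) {(A, K). K t \<noteq> 0}"
      using acceptance_no_backward[of T N \<omega> t forced] t by (simp add: accept_V_of)
    \<comment> \<open>Adding the factors before \<open>t\<close>, all in \<open>[0, 1]\<close>, only
      lowers the product.\<close>
    moreover have "(\<Prod>u\<in>{1..T}. accept N (\<omega> u)) \<le> (\<Prod>u\<in>{t..T}. accept N (\<omega> u))"
    proof -
      have "(\<Prod>u\<in>{1..T}. accept N (\<omega> u)) =
          (\<Prod>u\<in>{1..T} - {t..T}. accept N (\<omega> u)) * (\<Prod>u\<in>{t..T}. accept N (\<omega> u))"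
        using t by (intro prod.subset_diff) auto
      also have "\<dots> \<le> (\<Prod>u\<in>{t..T}. accept N (\<omega> u))"
        using accept_bounds by (intro mult_left_le_one_le prod_nonneg prod_le_1) auto
      finally show ?thesis .
    qed
    ultimately show "(\<Prod>u\<in>{1..T}. accept N (\<omega> u))
        \<le> measure_pmf.prob (indices_pmf forced False N T \<omega>) {(A, K). K t \<noteq> 0}" by simp
  qed
  ultimately show ?thesis by simp
qed

end

theorem proposition4p8:
  fixes M1 :: "real measure" and m1 :: "real \<Rightarrow> real"
    and M :: "nat \<Rightarrow> real \<Rightarrow> real measure" and m :: "nat \<Rightarrow> real \<Rightarrow> real \<Rightarrow> real"
    and G :: "nat \<Rightarrow> real \<Rightarrow> real" and \<l> :: "nat \<Rightarrow> real" and forced :: bool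
  assumes model: "feynman_kac_model M1 m1 M m G"
    and scale_pos: "\<And>t. 1 \<le> t \<Longrightarrow> 0 < \<l> t"
    and indep: "\<And>t x x'. 2 \<le> t \<Longrightarrow> M t x = M t x'"
    and m1_pos: "\<And>y. 0 < m1 y"
    and m_pos: "\<And>t x y. 2 \<le> t \<Longrightarrow> 0 < m t x y"
    and smooth: "\<And>T t. 1 \<le> t \<Longrightarrow> t \<le> T \<Longrightarrow> twice_cont_differentiable (log_weight m1 m G T t)"
    and lip_cur: "\<And>T t. 1 \<le> t \<Longrightarrow> t \<le> T \<Longrightarrow>
      lipschitz_bounded (partial_snd (partial_snd (log_weight m1 m G T t)))"
    and lip_next: "\<And>T t. 1 \<le> t \<Longrightarrow> t \<le> T \<Longrightarrow>
      lipschitz_bounded (partial_fst (partial_fst (log_weight m1 m G T (t + 1))))"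
    and lip_mixed: "\<And>T t. 1 \<le> t \<Longrightarrow> t \<le> T \<Longrightarrow>
      lipschitz_bounded (partial_fst (partial_snd (log_weight m1 m G T (t + 1))))"
    and moment_cur: "\<And>T t. 1 \<le> t \<Longrightarrow> t \<le> T \<Longrightarrow>
      (\<integral>\<^sup>+x. ennreal (\<bar>on_path t (partial_snd (log_weight m1 m G T t)) x\<bar> ^ 4)
        \<partial>target m1 m G T) < \<infinity>"
    and moment_next: "\<And>T t. 1 \<le> t \<Longrightarrow> t \<le> T \<Longrightarrow>
      (\<integral>\<^sup>+x. ennreal (\<bar>on_path (t + 1) (partial_fst (log_weight m1 m G T (t + 1))) x\<bar> ^ 4)
        \<partial>target m1 m G T) < \<infinity>"
    and fisher: "sup_fisher_info m1 m G \<l> < \<infinity>"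
  shows "(\<forall>(N :: nat \<Rightarrow> nat) (C :: real).
      0 < C \<and> (\<forall>T\<ge>1. C * real T \<le> real (N T)) \<longrightarrow>
        exp (- (exp (enn2real (sup_fisher_info m1 m G \<l>)) / C))
          \<le> (INF T\<in>{1..}. INF t\<in>{1..T}. acceptance_rate m1 m G \<l> forced False (N T) T t) \<and>
        0 < exp (- (exp (enn2real (sup_fisher_info m1 m G \<l>)) / C)))
    \<and> (\<forall>N :: nat. 1 \<le> N \<longrightarrow>
        inverse (1 + exp (enn2real (sup_fisher_info m1 m G \<l>)) / real N)
          \<le> (INF T\<in>{1..}. INF t\<in>{1..T}. acceptance_rate m1 m G \<l> forced True N T t) \<and>
        0 < inverse (1 + exp (enn2real (sup_fisher_info m1 m G \<l>)) / real N))"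
proof -
  interpret feynman_kac_model M1 m1 M m G by (rule model)
  interpret time_independent_model M1 m1 M m G \<l>
    by standard (use scale_pos indep m1_pos m_pos smooth lip_cur fisher in auto)
  let ?E = "exp (enn2real (sup_fisher_info m1 m G \<l>))"
  show ?thesis
  proof (intro conjI allI impI; (elim conjE)?)
    fix N :: "nat \<Rightarrow> nat" and C :: real
    assume C: "0 < C" "\<forall>T\<ge>1. C * real T \<le> real (N T)"
    show "exp (- (?E / C)) \<le> (INF T\<in>{1..}. INF t\<in>{1..T}. acceptance_rate m1 m G \<l> forced False (N T) T t)"
    proof (intro cINF_greatest)
      fix T t :: nat assume "T \<in> {1..}" and t: "t \<in> {1..T}"
      then have T: "1 \<le> T" and CT: "C * real T \<le> real (N T)" using C by auto
      have "0 < C * real T" using C T by simp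
      then have N: "0 < real (N T)" using CT by linarith
      \<comment> \<open>The linear growth of \<open>N\<close> exactly offsets the \<open>T\<close>
        factors of the product bound.\<close>
      have "real T * (?E / real (N T)) \<le> ?E / C"
        using mult_left_mono[OF CT, of ?E] C(1) N by (simp add: field_simps)
      then have "exp (- (?E / C)) \<le> exp (real T * - (?E / real (N T)))" by simp
      also have "\<dots> = inverse (exp (?E / real (N T))) ^ T"
        unfolding exp_of_nat_mult exp_minus ..
      \<comment> \<open>From \<open>1 + x \<le> exp x\<close>, inverted and raised to the power
        \<open>T\<close>.\<close>
      also have "\<dots> \<le> inverse (1 + ?E / real (N T)) ^ T"
        by (intro power_mono le_imp_inverse_le exp_ge_add_one_self) (auto intro: add_pos_nonneg)
      also have "\<dots> \<le> acceptance_rate m1 m G \<l> forced False (N T) T t"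
        using N t by (intro acceptance_rate_no_backward_ge) auto
      finally show "exp (- (?E / C)) \<le> acceptance_rate m1 m G \<l> forced False (N T) T t" .
    qed auto
  next
    fix N :: nat assume "1 \<le> N"
    then show "inverse (1 + ?E / real N)
        \<le> (INF T\<in>{1..}. INF t\<in>{1..T}. acceptance_rate m1 m G \<l> forced True N T t)"
      by (intro cINF_greatest acceptance_rate_backward_ge) auto
  next
    fix N :: nat
    show "0 < inverse (1 + ?E / real N)" by (simp add: add_pos_nonneg)
  qed simp
qed

end
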